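(* Let $G=P_2\times P_r$ for an odd number $r$, and let $\mathbf{k}$ be the degree-vector of $G$. Then $$\operatorname{proj\,dim}(S/\mathrm{NI}_{\mathbf{k}}(G))\ge r+1\qquad\text{and}\qquad\operatorname{depth}(S/\mathrm{NI}_{\mathbf{k}}(G))\le r-1.$$
   Context: $P_2\times P_r$ denotes the graph with vertex set $\{x_1,\ldots,x_r,y_1,\ldots,y_r\}$ and edge set $\{\{x_i,x_{i+1}\}:1\le i<r\}\cup\{\{y_i,y_{i+1}\}:1\le i<r\}\cup\{\{x_i,y_i\}:1\le i\le r\}$ (the Cartesian product of paths). $K$ is a field and $S$ is the polynomial ring over $K$ whose $2r$ variables are the vertices of $G$. $N_G[v]$ is the closed neighborhood of a vertex $v$. For $\mathbf{k}=(k_v)_{v\in V(G)}$ with $1\le k_v\le\deg_G(v)+1$, the $\mathbf{k}$-neighborhood ideal $\mathrm{NI}_{\mathbf{k}}(G)\subseteq S$ is generated by the squarefree monomials $\prod_{w\in W}w$ for all $W$ such that $W\subseteq N_G[v]$ and $|W|=k_v$ for some vertex $v$. The degree-vector is $\mathbf{k}$ with $k_v=\deg_G(v)$ for all $v$. *)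

theory Defs
  imports "HOL-Algebra.QuotRing" "HOL-Algebra.Module" "HOL-Library.Poly_Mapping"
    "HOL-Library.Extended_Nat"
begin

section \<open>Simple graphs and the ladder\<close>

record 'v graph =
  verts :: "'v set"
  edges :: "'v set set"

definition neighborhood :: "'v graph \<Rightarrow> 'v \<Rightarrow> 'v set" where
  "neighborhood G v = {w \<in> verts G. w \<noteq> v \<and> {v, w} \<in> edges G}"

definition closed_neighborhood :: "'v graph \<Rightarrow> 'v \<Rightarrow> 'v set" where
  "closed_neighborhood G v = insert v (neighborhood G v)"

definition degree :: "'v graph \<Rightarrow> 'v \<Rightarrow> nat" where
  "degree G v = card (neighborhood G v)"

datatype ladder_vertex = VX nat | VY nat

definition ladder :: "nat \<Rightarrow> ladder_vertex graph" where
  "ladder r = \<lparr>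
     verts = VX ` {1..r} \<union> VY ` {1..r},
     edges = {{VX i, VX (i + 1)} | i. 1 \<le> i \<and> i < r} \<union>
             {{VY i, VY (i + 1)} | i. 1 \<le> i \<and> i < r} \<union>
             {{VX i, VY i} | i. 1 \<le> i \<and> i \<le> r}\<rparr>"

section \<open>Polynomial rings and neighborhood ideals\<close>

text \<open>
  Exponent vectors are finitely supported maps into \<^typ>\<open>nat\<close>, and polynomials are finitely
  supported maps from exponent vectors to the field. The set \<open>V\<close> of variables may be a proper
  subset of the type \<open>'v\<close>, so the carrier consists of the polynomials all of whose monomials
  involve only variables from \<open>V\<close>.
\<close>

type_synonym ('v, 'k) mpoly = "('v \<Rightarrow>\<^sub>0 nat) \<Rightarrow>\<^sub>0 'k"

definition mvar :: "'v \<Rightarrow> ('v, 'k::field) mpoly" where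
  "mvar v = Poly_Mapping.single (Poly_Mapping.single v 1) 1"

definition poly_ring :: "'v set \<Rightarrow> ('v, 'k::field) mpoly ring" where
  "poly_ring V = \<lparr>
     carrier = {p. \<forall>m \<in> Poly_Mapping.keys p. Poly_Mapping.keys m \<subseteq> V},
     mult = (*), one = 1, zero = 0, add = (+)\<rparr>"

definition nbhd_ideal :: "'v graph \<Rightarrow> ('v \<Rightarrow> nat) \<Rightarrow> ('v, 'k::field) mpoly set" where
  "nbhd_ideal G k = genideal (poly_ring (verts G))
     {(\<Prod>w\<in>W. mvar w) | W v. v \<in> verts G \<and> W \<subseteq> closed_neighborhood G v \<and> card W = k v}"

definition irrelevant_ideal :: "'v set \<Rightarrow> ('v, 'k::field) mpoly set" where
  "irrelevant_ideal V = genideal (poly_ring V) (mvar ` V)"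

section \<open>Modules\<close>

text \<open>
  \<open>R/I\<close> as an \<open>R\<close>-module. The record type \<open>module\<close> extends \<open>ring\<close>; for modules the fields
  \<open>mult\<close> and \<open>one\<close> carry no information.
\<close>

definition quot_module :: "'a ring \<Rightarrow> 'a set \<Rightarrow> ('a, 'a set) module" where
  "quot_module R I = ring.extend (R Quot I)
     \<lparr>smult = (\<lambda>a X. (I +>\<^bsub>R\<^esub> a) \<otimes>\<^bsub>R Quot I\<^esub> X)\<rparr>"

definition free_module :: "'a ring \<Rightarrow> 'b set \<Rightarrow> ('a, 'b \<Rightarrow> 'a) module" where
  "free_module R B = \<lparr>
     carrier = {f. range f \<subseteq> carrier R \<and> finite {b. f b \<noteq> \<zero>\<^bsub>R\<^esub>} \<and> {b. f b \<noteq> \<zero>\<^bsub>R\<^esub>} \<subseteq> B},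
     mult = undefined, one = undefined,
     zero = (\<lambda>_. \<zero>\<^bsub>R\<^esub>), add = (\<lambda>f g b. f b \<oplus>\<^bsub>R\<^esub> g b),
     smult = (\<lambda>a f b. a \<otimes>\<^bsub>R\<^esub> f b)\<rparr>"

definition mod_hom :: "'a ring \<Rightarrow> ('a, 'b) module \<Rightarrow> ('a, 'c) module \<Rightarrow> ('b \<Rightarrow> 'c) set" where
  "mod_hom R M N = {f \<in> carrier M \<rightarrow> carrier N.
     (\<forall>x \<in> carrier M. \<forall>y \<in> carrier M. f (x \<oplus>\<^bsub>M\<^esub> y) = f x \<oplus>\<^bsub>N\<^esub> f y) \<and>
     (\<forall>a \<in> carrier R. \<forall>x \<in> carrier M. f (a \<odot>\<^bsub>M\<^esub> x) = a \<odot>\<^bsub>N\<^esub> f x)}"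

definition mod_ker :: "('a, 'b) module \<Rightarrow> ('a, 'c) module \<Rightarrow> ('b \<Rightarrow> 'c) \<Rightarrow> 'b set" where
  "mod_ker M N f = {x \<in> carrier M. f x = \<zero>\<^bsub>N\<^esub>}"

text \<open>
  A module is projective if it is a direct summand of a free module. It is no restriction to take
  the basis from the element type of \<open>P\<close>: if \<open>P\<close> is a summand of any free module, then the
  canonical surjection from the free module with basis \<^term>\<open>carrier P\<close> onto \<open>P\<close> splits.
\<close>

definition projective :: "'a ring \<Rightarrow> ('a, 'c) module \<Rightarrow> bool" where
  "projective R P \<longleftrightarrow> Module.module R P \<and>
     (\<exists>(B :: 'c set) s p. s \<in> mod_hom R P (free_module R B) \<and> p \<in> mod_hom R (free_module R B) P \<and>
        (\<forall>x \<in> carrier P. p (s x) = x))"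

section \<open>Projective dimension\<close>

text \<open>\<open>\<cdots> \<rightarrow> P 2 \<rightarrow> P 1 \<rightarrow> P 0 \<rightarrow> M \<rightarrow> 0\<close> with \<open>d i : P (i + 1) \<rightarrow> P i\<close> and augmentation \<open>e : P 0 \<rightarrow> M\<close>.\<close>

definition projective_resolution ::
  "'a ring \<Rightarrow> ('a, 'b) module \<Rightarrow> (nat \<Rightarrow> ('a, 'c) module) \<Rightarrow> (nat \<Rightarrow> 'c \<Rightarrow> 'c) \<Rightarrow> ('c \<Rightarrow> 'b) \<Rightarrow> bool"
where
  "projective_resolution R M P d e \<longleftrightarrow>
     (\<forall>i. projective R (P i)) \<and>
     e \<in> mod_hom R (P 0) M \<and>
     (\<forall>i. d i \<in> mod_hom R (P (Suc i)) (P i)) \<and>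
     e ` carrier (P 0) = carrier M \<and>
     d 0 ` carrier (P (Suc 0)) = mod_ker (P 0) M e \<and>
     (\<forall>i. d (Suc i) ` carrier (P (Suc (Suc i))) = mod_ker (P (Suc i)) (P i) (d i))"

text \<open>
  The least length of a projective resolution (\<open>\<infinity>\<close> if there is no finite one). Since a definition
  cannot quantify over types, the type \<open>'c\<close> of the elements of the modules in the resolution is
  an explicit parameter. Enlarging \<open>'c\<close> only adds resolutions, and for a finitely generated module
  over a noetherian ring with elements in \<open>'a\<close> every type at least as large as \<^typ>\<open>nat \<Rightarrow> 'a\<close> yields the
  true projective dimension. A lower bound for arbitrary \<open>'c\<close> is thus one for all projective
  resolutions.
\<close>

definition proj_dim :: "'c itself \<Rightarrow> 'a ring \<Rightarrow> ('a, 'b) module \<Rightarrow> enat" where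
  "proj_dim _ R M = Inf {enat n | n. \<exists>(P :: nat \<Rightarrow> ('a, 'c) module) d e.
     projective_resolution R M P d e \<and> (\<forall>i > n. carrier (P i) = {\<zero>\<^bsub>P i\<^esub>})}"

section \<open>Depth\<close>

text \<open>The submodule \<open>(A)M\<close> of \<open>M\<close> generated by all \<open>ax\<close>.\<close>

definition ideal_smult :: "'a ring \<Rightarrow> 'a set \<Rightarrow> ('a, 'b) module \<Rightarrow> 'b set" where
  "ideal_smult R A M = \<Inter>{N. submodule N R M \<and> (\<forall>a \<in> A. \<forall>x \<in> carrier M. a \<odot>\<^bsub>M\<^esub> x \<in> N)}"

text \<open>
  Each \<open>xs ! i\<close> is a nonzerodivisor on \<open>M/(xs ! 0, \<dots>, xs ! (i - 1))M\<close>, and \<open>M/(xs)M\<close> is nonzero.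
\<close>

definition regular_sequence :: "'a ring \<Rightarrow> ('a, 'b) module \<Rightarrow> 'a list \<Rightarrow> bool" where
  "regular_sequence R M xs \<longleftrightarrow>
     set xs \<subseteq> carrier R \<and>
     (\<forall>i < length xs. \<forall>m \<in> carrier M.
        (xs ! i) \<odot>\<^bsub>M\<^esub> m \<in> ideal_smult R (set (take i xs)) M \<longrightarrow>
        m \<in> ideal_smult R (set (take i xs)) M) \<and>
     ideal_smult R (set xs) M \<noteq> carrier M"

definition depth :: "'a ring \<Rightarrow> 'a set \<Rightarrow> ('a, 'b) module \<Rightarrow> enat" where
  "depth R J M = Sup {enat (length xs) | xs. set xs \<subseteq> J \<and> regular_sequence R M xs}"

end

theory Submission
  imports Defs
begin

text \<open>
  Let \<open>I\<close> be the ideal, \<open>V\<close> the set of variables, and let \<open>C\<close> consist of the vertices in the columns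
  with odd index. As \<open>r\<close> is odd, every closed neighborhood contains exactly two vertices of \<open>C\<close>: in
  an odd column these are the two ends of the rung, in an even column the left and the right
  neighbor. A generator of \<open>I\<close> omits only one vertex of a closed neighborhood, so it contains a
  variable from \<open>C\<close>, and \<open>I\<close> lies in the prime ideal \<open>P\<close> generated by \<open>C\<close>. Conversely, omitting the
  partner of \<open>c \<in> C\<close> from the closed neighborhood of \<open>c\<close> gives a generator whose only variable in
  \<open>C\<close> is \<open>c\<close>. Hence the product \<open>u\<close> of all variables outside \<open>C\<close> is not in \<open>I\<close>, but \<open>c u \<in> I\<close> for
  all \<open>c \<in> C\<close>: \<open>P\<close> is the annihilator of the class of \<open>u\<close>, an associated prime of height
  \<open>card C = r + 1\<close> and coheight \<open>r - 1\<close>. That an associated prime bounds the projective dimension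
  from below by its height and the depth from above by its coheight is general commutative
  algebra. For this prime both bounds have elementary proofs, given here.

  Projective dimension (\<open>proj_dim_ge\<close>). In terms of Koszul homology, \<open>u\<close> is a nonzero element of
  \<open>H\<^sub>n(C; S/I) = Tor\<^sub>n(S/P, S/I)\<close> for \<open>n = card C\<close>. Dimension shifting makes this concrete. The
  variables in \<open>C\<close> form a weakly regular sequence on every projective module, so a projective
  resolution stays exact modulo the first \<open>j\<close> of them in degrees above \<open>j\<close> (\<open>exact_modulo\<close>). Start
  with a lift of \<open>u\<close> to \<open>P 0\<close>, multiply by one variable after the other and lift the result along
  the differential each time (\<open>socle_chase\<close>). After \<open>n\<close> steps this gives a nonzero element of \<open>P n\<close>,
  so the resolution has length at least \<open>n\<close>.

  Depth (\<open>depth_le\<close>). Let \<open>f\<^sub>1, \<dots>, f\<^sub>t\<close> be regular on \<open>S/I\<close> and without constant terms. Powers of a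
  regular sequence form a regular sequence (\<open>regular_powers\<close>), and for degree reasons a nonzero
  constant multiple of \<open>u\<close> is not in the ideal generated by \<open>I\<close> and sufficiently high powers \<open>g\<^sub>i\<close> of
  the \<open>f\<^sub>i\<close>. Then no nontrivial \<open>K\<close>-linear combination of monomials in the \<open>g\<^sub>i\<close> kills \<open>u\<close> modulo \<open>I\<close>
  (\<open>regular_monomials_independent\<close>). But whether a polynomial kills \<open>u\<close> only depends on its terms in
  the \<open>q = card (V - C)\<close> variables outside \<open>C\<close>. Monomials in the \<open>g\<^sub>i\<close> with exponents below \<open>B\<close>
  give \<open>B\<^sup>t\<close> polynomials, which involve only \<open>O(B\<^sup>q)\<close> such terms, so \<open>t \<le> q\<close>.
\<close>

section \<open>Polynomials supported on given monomials\<close>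

lemma keys_add_nat: "Poly_Mapping.keys (a + b :: 'v \<Rightarrow>\<^sub>0 nat) = Poly_Mapping.keys a \<union> Poly_Mapping.keys b"
  by (auto simp: in_keys_iff lookup_add)

text \<open>
  The polynomial ring itself and the ideals that \<open>I\<close> is compared with are given by conditions on
  the monomials that occur in a polynomial. Closure properties are stated once, for an arbitrary
  predicate \<open>Q\<close> on exponent vectors.
\<close>

definition supported :: "('m \<Rightarrow> bool) \<Rightarrow> ('m \<Rightarrow>\<^sub>0 'k::zero) \<Rightarrow> bool" where
  "supported Q p \<longleftrightarrow> (\<forall>m\<in>Poly_Mapping.keys p. Q m)"

text \<open>
  A polynomial lies in the prime ideal generated by the variables in \<open>C\<close> iff each of its monomials
  does.
\<close>

abbreviation meets :: "'v set \<Rightarrow> ('v, 'k::zero) mpoly \<Rightarrow> bool" where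
  "meets C \<equiv> supported (\<lambda>m. Poly_Mapping.keys m \<inter> C \<noteq> {})"

lemma supported_zero [simp]: "supported Q 0"
  by (simp add: supported_def)

lemma supported_mono: "supported P p \<Longrightarrow> (\<And>m. P m \<Longrightarrow> Q m) \<Longrightarrow> supported Q p"
  by (auto simp: supported_def)

lemma supported_add: "supported Q p \<Longrightarrow> supported Q q \<Longrightarrow> supported Q (p + q)"
  using keys_add[of p q] by (auto simp: supported_def)

lemma supported_uminus: "supported Q p \<Longrightarrow> supported Q (- p :: 'm \<Rightarrow>\<^sub>0 'k::ab_group_add)"
  by (auto simp: supported_def in_keys_iff)

lemma supported_sum: "(\<And>x. x \<in> X \<Longrightarrow> supported Q (f x)) \<Longrightarrow> supported Q (sum f X)"
  by (induction X rule: infinite_finite_induct) (auto intro: supported_add)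

lemma supported_mult:
  assumes "supported P p" "supported Q q" "\<And>a b. P a \<Longrightarrow> Q b \<Longrightarrow> R (a + b)"
  shows "supported R (p * q)"
  using assms keys_mult[of p q] by (fastforce simp: supported_def)

lemma supported_single: "Q m \<Longrightarrow> supported Q (Poly_Mapping.single m c)"
  by (auto simp: supported_def)

lemma supported_mvar: "Q (Poly_Mapping.single v 1) \<Longrightarrow> supported Q (mvar v)"
  by (simp add: mvar_def supported_single)

lemma sum_monomials:
  fixes p :: "'m \<Rightarrow>\<^sub>0 'k::comm_monoid_add"
  shows "(\<Sum>m\<in>Poly_Mapping.keys p. Poly_Mapping.single m (Poly_Mapping.lookup p m)) = p"
proof (rule poly_mapping_eqI)
  fix k
  have "(\<Sum>m\<in>Poly_Mapping.keys p. (Poly_Mapping.lookup p m when m = k))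
      = (\<Sum>m\<in>Poly_Mapping.keys p. if m = k then Poly_Mapping.lookup p m else 0)"
    by (intro sum.cong) (auto simp: when_def)
  then show "Poly_Mapping.lookup (\<Sum>m\<in>Poly_Mapping.keys p. Poly_Mapping.single m (Poly_Mapping.lookup p m)) k
      = Poly_Mapping.lookup p k"
    by (simp add: lookup_sum lookup_single in_keys_iff)
qed

lemma lookup_mvar_mult:
  fixes p :: "('v, 'k::field) mpoly"
  shows "Poly_Mapping.lookup (mvar v * p) (Poly_Mapping.single v 1 + m) = Poly_Mapping.lookup p m"
proof -
  let ?l = "Poly_Mapping.lookup" and ?s = "Poly_Mapping.single v (1::nat)"
  have "mvar v * p = mvar v * (\<Sum>k\<in>Poly_Mapping.keys p. Poly_Mapping.single k (?l p k))"
    by (simp add: sum_monomials)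
  also have "\<dots> = (\<Sum>k\<in>Poly_Mapping.keys p. Poly_Mapping.single (?s + k) (?l p k))"
    by (simp add: sum_distrib_left mvar_def mult_single)
  finally have "?l (mvar v * p) (?s + m) = (\<Sum>k\<in>Poly_Mapping.keys p. if k = m then ?l p k else 0)"
    by (auto simp: lookup_sum lookup_single when_def intro!: sum.cong)
  then show ?thesis
    by (simp add: in_keys_iff)
qed

text \<open>
  Multiplication by a variable shifts the monomials injectively, so nothing cancels and conditions
  on the product give conditions on the factor. This is why a variable is a nonzerodivisor modulo
  other variables.
\<close>

lemma supported_of_mvar_mult:
  assumes "supported Q (mvar v * p)" "\<And>m. Q (Poly_Mapping.single v 1 + m) \<Longrightarrow> R m"
  shows "supported R p"
  unfolding supported_def
proof
  fix m assume "m \<in> Poly_Mapping.keys p"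
  then have "Poly_Mapping.single v 1 + m \<in> Poly_Mapping.keys (mvar v * p)"
    by (simp add: in_keys_iff lookup_mvar_mult del: One_nat_def)
  then show "R m" using assms by (auto simp: supported_def)
qed

lemma carrier_poly_ring: "p \<in> carrier (poly_ring V) \<longleftrightarrow> supported (\<lambda>m. Poly_Mapping.keys m \<subseteq> V) p"
  by (simp add: poly_ring_def supported_def)

text \<open>
  Division with remainder by a variable: \<open>g\<close> collects the monomials divisible by \<open>v\<close>. The last
  conclusion makes a pointwise splitting of an element of a free module have finite support again.
\<close>

lemma poly_split:
  fixes p :: "('v, 'k::field) mpoly"
  assumes "p \<in> carrier (poly_ring V)"
  obtains g h where "p = mvar v * g + h" "g \<in> carrier (poly_ring V)" "h \<in> carrier (poly_ring V)"
    "Poly_Mapping.keys h \<subseteq> {m \<in> Poly_Mapping.keys p. v \<notin> Poly_Mapping.keys m}"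
    "p = 0 \<longrightarrow> g = 0 \<and> h = 0"
proof -
  let ?l = "Poly_Mapping.lookup" and ?k = "Poly_Mapping.keys p" and ?s = "Poly_Mapping.single v (1::nat)"
  define X where "X = {m \<in> ?k. v \<in> Poly_Mapping.keys m}"
  define g where "g = (\<Sum>m\<in>X. Poly_Mapping.single (m - ?s) (?l p m))"
  define h where "h = (\<Sum>m\<in>?k - X. Poly_Mapping.single m (?l p m))"
  have *: "?s + (m - ?s) = m" if "m \<in> X" for m
    using that by (intro poly_mapping_eqI)
      (auto simp: X_def lookup_add lookup_minus lookup_single when_def in_keys_iff)
  have "mvar v * g = (\<Sum>m\<in>X. Poly_Mapping.single m (?l p m))"
    unfolding g_def sum_distrib_left using * by (intro sum.cong) (auto simp: mvar_def mult_single)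
  then have "mvar v * g + h = p"
    unfolding h_def using sum.subset_diff[of X ?k "\<lambda>m. Poly_Mapping.single m (?l p m)"]
    by (simp add: X_def add.commute sum_monomials)
  then have "p = mvar v * g + h" by simp
  moreover have "g \<in> carrier (poly_ring V)"
    unfolding g_def carrier_poly_ring
  proof (intro supported_sum supported_single)
    fix m assume m: "m \<in> X"
    have "Poly_Mapping.keys (m - ?s) \<subseteq> Poly_Mapping.keys m"
      using keys_add_nat[of ?s "m - ?s"] *[OF m] by auto
    then show "Poly_Mapping.keys (m - ?s) \<subseteq> V"
      using assms m by (auto simp: carrier_poly_ring supported_def X_def)
  qed
  moreover have h: "Poly_Mapping.keys h \<subseteq> {m \<in> ?k. v \<notin> Poly_Mapping.keys m}"
  proof -
    have "supported (\<lambda>m. m \<in> ?k - X) h"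
      unfolding h_def by (intro supported_sum supported_single)
    then show ?thesis by (auto simp: supported_def X_def)
  qed
  moreover from h assms have "h \<in> carrier (poly_ring V)"
    by (auto simp: carrier_poly_ring supported_def)
  moreover have "p = 0 \<longrightarrow> g = 0 \<and> h = 0"
    by (simp add: g_def h_def X_def)
  ultimately show ?thesis by (intro that)
qed

lemma poly_ring_simps [simp]:
  "\<zero>\<^bsub>poly_ring V\<^esub> = 0" "\<one>\<^bsub>poly_ring V\<^esub> = 1"
  "p \<oplus>\<^bsub>poly_ring V\<^esub> q = p + q" "p \<otimes>\<^bsub>poly_ring V\<^esub> q = p * q"
  by (simp_all add: poly_ring_def)

lemma poly_ring_closed:
  fixes p q :: "('v, 'k::field) mpoly"
  shows "(0 :: ('v, 'k) mpoly) \<in> carrier (poly_ring V)"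
    and "(1 :: ('v, 'k) mpoly) \<in> carrier (poly_ring V)"
    and "p \<in> carrier (poly_ring V) \<Longrightarrow> q \<in> carrier (poly_ring V) \<Longrightarrow> p + q \<in> carrier (poly_ring V)"
    and "p \<in> carrier (poly_ring V) \<Longrightarrow> q \<in> carrier (poly_ring V) \<Longrightarrow> p * q \<in> carrier (poly_ring V)"
    and "p \<in> carrier (poly_ring V) \<Longrightarrow> - p \<in> carrier (poly_ring V)"
  unfolding carrier_poly_ring
  by (simp_all add: supported_add supported_uminus supported_def[of _ 1])
    (erule supported_mult, assumption, simp add: keys_add_nat)

lemma mvar_in_poly_ring: "v \<in> V \<Longrightarrow> mvar v \<in> carrier (poly_ring V)"
  by (simp add: carrier_poly_ring supported_mvar)

lemma single_0_in_poly_ring: "Poly_Mapping.single 0 c \<in> carrier (poly_ring V)"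
  by (simp add: carrier_poly_ring supported_single)

lemma cring_poly_ring: "cring (poly_ring V :: ('v, 'k::field) mpoly ring)"
proof (rule cringI)
  show "abelian_group (poly_ring V :: ('v, 'k) mpoly ring)"
  proof (rule abelian_groupI)
    fix x :: "('v, 'k) mpoly" assume "x \<in> carrier (poly_ring V)"
    then show "\<exists>y\<in>carrier (poly_ring V). y \<oplus>\<^bsub>poly_ring V\<^esub> x = \<zero>\<^bsub>poly_ring V\<^esub>"
      by (intro bexI[of _ "- x"]) (auto simp: poly_ring_closed)
  qed (auto simp: poly_ring_closed algebra_simps)
  show "Group.comm_monoid (poly_ring V :: ('v, 'k) mpoly ring)"
    by (rule comm_monoidI) (auto simp: poly_ring_closed algebra_simps)
qed (auto simp: algebra_simps)

lemma mvar_prod_eq_single: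
  "finite W \<Longrightarrow> (\<Prod>w\<in>W. mvar w :: ('v, 'k::field) mpoly)
     = Poly_Mapping.single (\<Sum>w\<in>W. Poly_Mapping.single w 1) 1"
  by (induction W rule: finite_induct) (auto simp: mvar_def mult_single)

lemma lookup_sum_singles:
  "finite W \<Longrightarrow> Poly_Mapping.lookup (\<Sum>w\<in>W. Poly_Mapping.single w (1::nat)) v = (if v \<in> W then 1 else 0)"
  by (simp add: lookup_sum lookup_single when_def)

lemma keys_sum_singles:
  "finite W \<Longrightarrow> Poly_Mapping.keys (\<Sum>w\<in>W. Poly_Mapping.single w (1::nat)) = W"
  by (auto simp: in_keys_iff lookup_sum_singles simp del: One_nat_def split: if_splits)

lemma ideal_supported:
  assumes "\<And>a b. Q a \<Longrightarrow> Q (a + b)"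
  shows "ideal {p \<in> carrier (poly_ring V). supported Q p} (poly_ring V :: ('v, 'k::field) mpoly ring)"
    (is "ideal ?I ?S")
proof -
  interpret cring ?S by (rule cring_poly_ring)
  have inv: "\<ominus>\<^bsub>?S\<^esub> p = - p" if "p \<in> carrier ?S" for p
    using that by (intro minus_equality) (auto simp: poly_ring_closed)
  have mult: "q * p \<in> ?I" if "p \<in> ?I" "q \<in> carrier ?S" for p q
  proof -
    have "supported Q (p * q)"
      using that assms by (intro supported_mult[of Q p "\<lambda>_. True" q Q]) (auto simp: supported_def)
    then show ?thesis using that by (simp add: poly_ring_closed mult.commute)
  qed
  have "subgroup ?I (add_monoid ?S)"
    by (rule group.subgroupI[OF a_group])
      (use inv in \<open>auto simp: poly_ring_closed supported_add supported_uminus a_inv_def intro!: exI[of _ 0]\<close>)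
  then show ?thesis
    by (rule idealI[OF ring_axioms]) (use mult in \<open>auto simp: mult.commute\<close>)
qed

text \<open>
  If all monomials of \<open>p\<close> involve a variable from \<open>C\<close>, then \<open>p\<close> is in the ideal generated by
  \<open>C\<close>, by splitting off one variable at a time; and that ideal multiplies \<open>u\<close> into \<open>I\<close>.
\<close>

lemma mult_in_ideal:
  fixes p u :: "('v, 'k::field) mpoly"
  assumes I: "ideal I (poly_ring V)" and "finite C" "C \<subseteq> V"
    and u: "u \<in> carrier (poly_ring V)" "\<And>c. c \<in> C \<Longrightarrow> mvar c * u \<in> I"
    and p: "p \<in> carrier (poly_ring V)" "meets C p"
  shows "p * u \<in> I"
  using \<open>finite C\<close> \<open>C \<subseteq> V\<close> u(2) p
proof (induction C arbitrary: p rule: finite_induct)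
  case empty
  then have "p = 0" by (auto simp: supported_def)
  then show ?case using ideal.axioms(1)[OF I] additive_subgroup.zero_closed by fastforce
next
  case (insert c C)
  obtain g h where gh: "p = mvar c * g + h" "g \<in> carrier (poly_ring V)"
    and h: "h \<in> carrier (poly_ring V)"
    and supp: "Poly_Mapping.keys h \<subseteq> {m \<in> Poly_Mapping.keys p. c \<notin> Poly_Mapping.keys m}"
    and "p = 0 \<longrightarrow> g = 0 \<and> h = 0"
    using insert.prems(3) by (rule poly_split[where v = c])
  have "meets C h"
    using supp insert.prems(4) by (fastforce simp: supported_def)
  then have "h * u \<in> I" using insert h by auto
  moreover have "g * (mvar c * u) \<in> I"
    using ideal.I_l_closed[OF I, of "mvar c * u" g] insert.prems(2) gh(2) by simp
  ultimately have "g * (mvar c * u) + h * u \<in> I"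
    using additive_subgroup.a_closed[OF ideal.axioms(1)[OF I]] by fastforce
  then show ?case by (simp add: gh(1) algebra_simps)
qed

text \<open>
  Gaussian elimination: an equation in which some unknown \<open>x0\<close> has a nonzero coefficient is used to
  eliminate \<open>x0\<close> from the others.
\<close>

section \<open>Linear systems with more unknowns than equations\<close>

lemma underdetermined_system_solvable:
  fixes c :: "'x \<Rightarrow> 'y \<Rightarrow> 'k::field"
  assumes "finite Y" "finite X" "card Y < card X"
  shows "\<exists>a. (\<exists>x\<in>X. a x \<noteq> 0) \<and> (\<forall>y\<in>Y. (\<Sum>x\<in>X. a x * c x y) = 0)"
  using assms
proof (induction Y arbitrary: X c rule: finite_induct)
  case empty
  then show ?case by (intro exI[of _ "\<lambda>_. 1"]) (auto simp: card_gt_0_iff)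
next
  case (insert y Y)
  show ?case
  proof (cases "\<forall>x\<in>X. c x y = 0")
    case True
    with insert.IH[of X c] insert.hyps insert.prems show ?thesis by auto
  next
    case False
    then obtain x0 where x0: "x0 \<in> X" "c x0 y \<noteq> 0" by auto
    define X' where "X' = X - {x0}"
    define c' where "c' x z = c x z - c x y / c x0 y * c x0 z" for x z
    have X': "finite X'" "X = insert x0 X'" "x0 \<notin> X'"
      using insert.prems x0 by (auto simp: X'_def)
    then have "card Y < card X'"
      using insert.prems insert.hyps by simp
    with insert.IH[of X' c'] X' obtain a x1 where a: "x1 \<in> X'" "a x1 \<noteq> 0"
      "\<And>z. z \<in> Y \<Longrightarrow> (\<Sum>x\<in>X'. a x * c' x z) = 0" by blast
    define b where "b = a(x0 := - (\<Sum>x\<in>X'. a x * c x y) / c x0 y)"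
    have b: "(\<Sum>x\<in>X. b x * c x z) = (\<Sum>x\<in>X'. a x * c' x z)" for z
    proof -
      have "(\<Sum>x\<in>X'. b x * c x z) = (\<Sum>x\<in>X'. a x * c x z)"
        using X'(3) by (intro sum.cong) (auto simp: b_def)
      then show ?thesis
        using X' by (simp add: b_def c'_def algebra_simps sum_subtractf sum_distrib_left sum_divide_distrib)
    qed
    have "(\<Sum>x\<in>X'. a x * c' x y) = 0"
      using x0(2) by (simp add: c'_def)
    moreover have "b x1 \<noteq> 0" "x1 \<in> X" using a X' by (auto simp: b_def)
    ultimately show ?thesis using a b by (intro exI[of _ b]) auto
  qed
qed

section \<open>Regular sequences modulo an ideal\<close>

fun power_product :: "'a::comm_ring_1 list \<Rightarrow> nat list \<Rightarrow> 'a" where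
  "power_product (g # gs) (n # ns) = g ^ n * power_product gs ns"
| "power_product _ _ = 1"

lemma sum_lists_Suc:
  "(\<Sum>ns\<in>{ns. set ns \<subseteq> {..<B} \<and> length ns = Suc t}. F ns)
     = (\<Sum>n<B. \<Sum>ns\<in>{ns. set ns \<subseteq> {..<B} \<and> length ns = t}. (F (n # ns) :: 'b::comm_monoid_add))"
proof -
  have "{ns. set ns \<subseteq> {..<B} \<and> length ns = Suc t}
      = (\<lambda>(n, ns). n # ns) ` ({..<B} \<times> {ns. set ns \<subseteq> {..<B} \<and> length ns = t})"
  proof (intro equalityI subsetI)
    fix ns assume "ns \<in> {ns. set ns \<subseteq> {..<B} \<and> length ns = Suc t}"
    then obtain n ns' where "ns = n # ns'" "n < B" "set ns' \<subseteq> {..<B}" "length ns' = t"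
      by (cases ns) auto
    then show "ns \<in> (\<lambda>(n, ns). n # ns) ` ({..<B} \<times> {ns. set ns \<subseteq> {..<B} \<and> length ns = t})"
      by (intro image_eqI[of _ _ "(n, ns')"]) auto
  qed auto
  moreover have "inj_on (\<lambda>(n, ns). n # ns) ({..<B} \<times> {ns. set ns \<subseteq> {..<B} \<and> length ns = t})"
    by (auto simp: inj_on_def)
  ultimately have "(\<Sum>ns\<in>{ns. set ns \<subseteq> {..<B} \<and> length ns = Suc t}. F ns)
      = (\<Sum>(n, ns)\<in>{..<B} \<times> {ns. set ns \<subseteq> {..<B} \<and> length ns = t}. F (n # ns))"
    by (simp add: sum.reindex case_prod_unfold)
  then show ?thesis
    by (simp only: sum.cartesian_product)
qed

text \<open>
  Regular sequences are studied in a subring of a type of class \<open>comm_ring_1\<close>, as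
  \<^term>\<open>poly_ring V\<close> is one; the ring operations are then those of the type. A submodule of \<open>A/J\<close> is
  represented by the ideal of \<open>A\<close> that is its preimage.
\<close>

locale subring_set =
  fixes A :: "'a::comm_ring_1 set"
  assumes zero: "0 \<in> A" and one: "1 \<in> A"
    and add: "x \<in> A \<Longrightarrow> y \<in> A \<Longrightarrow> x + y \<in> A"
    and mult: "x \<in> A \<Longrightarrow> y \<in> A \<Longrightarrow> x * y \<in> A"
    and minus: "x \<in> A \<Longrightarrow> - x \<in> A"
begin

lemma diff: "x \<in> A \<Longrightarrow> y \<in> A \<Longrightarrow> x - y \<in> A"
  using add[of x "- y"] minus[of y] by simp

lemma power: "x \<in> A \<Longrightarrow> x ^ n \<in> A"
  by (induction n) (auto simp: one mult)

lemma sum: "(\<And>i. i \<in> X \<Longrightarrow> f i \<in> A) \<Longrightarrow> sum f X \<in> A"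
  by (induction X rule: infinite_finite_induct) (auto simp: zero add)

definition is_ideal :: "'a set \<Rightarrow> bool" where
  "is_ideal J \<longleftrightarrow> J \<subseteq> A \<and> 0 \<in> J \<and> (\<forall>x\<in>J. \<forall>y\<in>J. x + y \<in> J) \<and> (\<forall>a\<in>A. \<forall>x\<in>J. a * x \<in> J)"

lemma is_idealD:
  assumes "is_ideal J"
  shows "x \<in> J \<Longrightarrow> x \<in> A" "0 \<in> J" "x \<in> J \<Longrightarrow> y \<in> J \<Longrightarrow> x + y \<in> J"
    "a \<in> A \<Longrightarrow> x \<in> J \<Longrightarrow> a * x \<in> J" "a \<in> A \<Longrightarrow> x \<in> J \<Longrightarrow> x * a \<in> J"
    "x \<in> J \<Longrightarrow> y \<in> J \<Longrightarrow> x - y \<in> J"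
proof -
  show "x \<in> J \<Longrightarrow> y \<in> J \<Longrightarrow> x - y \<in> J"
    using assms minus[OF one] unfolding is_ideal_def
    by (metis diff_conv_add_uminus mult_minus1)
qed (use assms in \<open>auto simp: is_ideal_def mult.commute\<close>)

definition adjoin :: "'a set \<Rightarrow> 'a \<Rightarrow> 'a set" where
  "adjoin J f = {x + f * b | x b. x \<in> J \<and> b \<in> A}"

lemma adjoinI: "x \<in> J \<Longrightarrow> b \<in> A \<Longrightarrow> x + f * b \<in> adjoin J f"
  by (auto simp: adjoin_def)

lemma subset_adjoin: "J \<subseteq> adjoin J f"
  using adjoinI[of _ J 0 f] zero by auto

lemma is_ideal_adjoin:
  assumes "is_ideal J" "f \<in> A"
  shows "is_ideal (adjoin J f)"
  unfolding is_ideal_def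
proof (intro conjI ballI)
  show "adjoin J f \<subseteq> A"
    using assms is_idealD[OF assms(1)] by (auto simp: adjoin_def add mult)
  show "0 \<in> adjoin J f"
    using is_idealD(2)[OF assms(1)] subset_adjoin by blast
next
  fix x y assume "x \<in> adjoin J f" "y \<in> adjoin J f"
  then obtain x' y' a b where "x = x' + f * a" "y = y' + f * b" "x' \<in> J" "y' \<in> J" "a \<in> A" "b \<in> A"
    by (auto simp: adjoin_def)
  moreover from this have "(x' + y') + f * (a + b) \<in> adjoin J f"
    using is_idealD[OF assms(1)] add by (intro adjoinI) auto
  ultimately show "x + y \<in> adjoin J f" by (simp add: algebra_simps)
next
  fix a x assume "a \<in> A" "x \<in> adjoin J f"
  moreover then obtain x' b where "x = x' + f * b" "x' \<in> J" "b \<in> A"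
    by (auto simp: adjoin_def)
  moreover from calculation have "a * x' + f * (a * b) \<in> adjoin J f"
    using is_idealD[OF assms(1)] mult by (intro adjoinI) auto
  ultimately show "a * x \<in> adjoin J f" by (simp add: algebra_simps)
qed

lemma adjoin_commute: "adjoin (adjoin J f) g = adjoin (adjoin J g) f"
  unfolding adjoin_def by (auto simp: algebra_simps) (metis add.commute add.left_commute)+

lemma is_ideal_foldl: "is_ideal J \<Longrightarrow> set fs \<subseteq> A \<Longrightarrow> is_ideal (foldl adjoin J fs)"
  by (induction fs arbitrary: J) (auto simp: is_ideal_adjoin)

definition nonzerodivisor :: "'a set \<Rightarrow> 'a \<Rightarrow> bool" where
  "nonzerodivisor J f \<longleftrightarrow> f \<in> A \<and> (\<forall>x\<in>A. f * x \<in> J \<longrightarrow> x \<in> J)"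

lemma nonzerodivisorD:
  "nonzerodivisor J f \<Longrightarrow> f \<in> A"
  "nonzerodivisor J f \<Longrightarrow> x \<in> A \<Longrightarrow> f * x \<in> J \<Longrightarrow> x \<in> J"
  by (auto simp: nonzerodivisor_def)

text \<open>
  Weak regularity on \<open>A/J\<close>: the last quotient may be zero. In this form regularity passes to
  extensions of modules.
\<close>

fun regular :: "'a set \<Rightarrow> 'a list \<Rightarrow> bool" where
  "regular J [] \<longleftrightarrow> True"
| "regular J (f # fs) \<longleftrightarrow> nonzerodivisor J f \<and> regular (adjoin J f) fs"

lemma regular_subset: "regular J fs \<Longrightarrow> set fs \<subseteq> A"
  by (induction J fs rule: regular.induct) (auto dest: nonzerodivisorD)

text \<open>
  The sequence \<open>0 \<rightarrow> A/(J : f) \<rightarrow> A/J \<rightarrow> A/(J + fA) \<rightarrow> 0\<close>, whose first map is multiplication by \<open>f\<close>,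
  is exact. A sequence that is regular on both ends is regular on the middle term, and each step
  \<open>J \<mapsto> J + gA\<close> preserves this situation because \<open>g\<close> is a nonzerodivisor on the cokernel.
\<close>

lemma regular_extension:
  assumes "is_ideal J" "f \<in> A"
    and "regular {x \<in> A. f * x \<in> J} gs" "regular (adjoin J f) gs"
  shows "regular J gs"
  using assms
proof (induction gs arbitrary: J)
  case (Cons g gs)
  note J = is_idealD[OF Cons.prems(1)]
  note J' = is_idealD[OF is_ideal_adjoin[OF Cons.prems(1,2)]]
  let ?X = "{x \<in> A. f * x \<in> J}"
  have X: "x \<in> ?X" if "x \<in> A" "g * x \<in> ?X" for x
    using Cons.prems(3) nonzerodivisorD(2) that by (metis regular.simps(2))
  have Z: "x \<in> adjoin J f" if "x \<in> A" "g * x \<in> adjoin J f" for x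
    using Cons.prems(4) nonzerodivisorD(2) that by (metis regular.simps(2))
  have g: "g \<in> A" using Cons.prems(4) by (auto dest: nonzerodivisorD(1))
  have nzd: "x \<in> J" if x: "x \<in> A" "g * x \<in> J" for x
  proof -
    obtain y b where yb: "x = y + f * b" "y \<in> J" "b \<in> A"
      using Z[OF x(1) subsetD[OF subset_adjoin x(2)]] by (auto simp: adjoin_def)
    have "g * x - g * y \<in> J" by (rule J(6)[OF x(2) J(4)[OF g yb(2)]])
    then have "f * (g * b) \<in> J" by (simp add: yb algebra_simps)
    with mult[OF g yb(3)] have "g * b \<in> ?X" by simp
    from X[OF yb(3) this] have "b \<in> ?X" .
    then show "x \<in> J" using yb(1,2) J(3) by auto
  qed
  then have "nonzerodivisor J g" using g by (simp add: nonzerodivisor_def)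
  moreover have "regular (adjoin J g) gs"
  proof (rule Cons.IH)
    show "is_ideal (adjoin J g)" "f \<in> A" using Cons.prems g is_ideal_adjoin by auto
    show "regular (adjoin (adjoin J g) f) gs" using Cons.prems(4) by (simp add: adjoin_commute)
    \<comment> \<open>The kernel term after adjoining \<open>g\<close>: if \<open>f x = y + g b\<close>, then \<open>b = y' + f b'\<close> as \<open>g\<close> is regular on the cokernel, and \<open>x - g b'\<close> is in the kernel term.\<close>
    have "{x \<in> A. f * x \<in> adjoin J g} = adjoin ?X g"
    proof (intro equalityI subsetI)
      fix x assume "x \<in> {x \<in> A. f * x \<in> adjoin J g}"
      then obtain y b where yb: "x \<in> A" "f * x = y + g * b" "y \<in> J" "b \<in> A"
        by (auto simp: adjoin_def)
      have "g * b = - y + f * x" using yb by simp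
      also have "\<dots> \<in> adjoin J f" using yb J(6)[OF J(2), of y] by (intro adjoinI) auto
      finally obtain y' b' where yb': "b = y' + f * b'" "y' \<in> J" "b' \<in> A"
        using Z[OF yb(4)] by (auto simp: adjoin_def)
      have "f * (x - g * b') = y + g * y'"
        using yb(2) yb'(1) by (simp add: algebra_simps)
      also have "\<dots> \<in> J" by (rule J(3)[OF yb(3) J(4)[OF g yb'(2)]])
      finally have "x - g * b' \<in> ?X" using diff[OF yb(1) mult[OF g yb'(3)]] by simp
      from adjoinI[OF this yb'(3), of g] show "x \<in> adjoin ?X g" by simp
    next
      fix x assume "x \<in> adjoin ?X g"
      then obtain y b where "x = y + g * b" "y \<in> A" "f * y \<in> J" "b \<in> A" by (auto simp: adjoin_def)
      moreover from this have "f * y + g * (f * b) \<in> adjoin J g"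
        using Cons.prems(2) mult by (intro adjoinI) auto
      ultimately show "x \<in> {x \<in> A. f * x \<in> adjoin J g}"
        using g mult add by (auto simp: algebra_simps)
    qed
    then show "regular {x \<in> A. f * x \<in> adjoin J g} gs" using Cons.prems(3) by simp
  qed
  ultimately show ?case by simp
qed simp

lemma nonzerodivisor_power:
  assumes "nonzerodivisor J f"
  shows "nonzerodivisor J (f ^ n)"
proof (induction n)
  case (Suc n)
  have "x \<in> J" if x: "x \<in> A" "f ^ Suc n * x \<in> J" for x
  proof -
    have "f ^ n * x \<in> J"
      using assms by (rule nonzerodivisorD(2))
        (use x in \<open>simp_all add: mult power nonzerodivisorD(1)[OF assms] mult.assoc\<close>)
    with Suc x(1) show ?thesis by (blast dest: nonzerodivisorD(2))
  qed
  then show ?case unfolding nonzerodivisor_def using nonzerodivisorD(1)[OF assms] power by blast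
qed (simp add: nonzerodivisor_def one)

text \<open>
  Induction on the exponent, as \<open>A/(J + f\<^sup>n\<^sup>+\<^sup>1A)\<close> is an extension of \<open>A/(J + fA)\<close> by
  \<open>A/(J + f\<^sup>nA)\<close>.
\<close>

lemma regular_power_head:
  assumes J: "is_ideal J" and nzd: "nonzerodivisor J f" and gs: "regular (adjoin J f) gs"
  shows "regular (adjoin J (f ^ Suc n)) gs"
proof (induction n)
  case 0 then show ?case using gs by simp
next
  case (Suc n)
  let ?Y = "adjoin J (f ^ Suc (Suc n))"
  note f = nonzerodivisorD[OF nzd]
  note J' = is_idealD[OF J]
  have "{x \<in> A. f * x \<in> ?Y} = adjoin J (f ^ Suc n)"
  proof (intro equalityI subsetI)
    fix x assume "x \<in> {x \<in> A. f * x \<in> ?Y}"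
    then obtain y b where yb: "x \<in> A" "f * x = y + f ^ Suc (Suc n) * b" "y \<in> J" "b \<in> A"
      by (auto simp: adjoin_def)
    have "f * (x - f ^ Suc n * b) \<in> J" using yb by (simp add: algebra_simps)
    then have "x - f ^ Suc n * b \<in> J"
      using f(2)[of "x - f ^ Suc n * b"] diff[OF yb(1) mult[OF power[OF f(1)] yb(4)]] by blast
    from adjoinI[OF this yb(4), of "f ^ Suc n"] show "x \<in> adjoin J (f ^ Suc n)" by simp
  next
    fix x assume "x \<in> adjoin J (f ^ Suc n)"
    then obtain y b where yb: "x = y + f ^ Suc n * b" "y \<in> J" "b \<in> A" by (auto simp: adjoin_def)
    have "f * y + f ^ Suc (Suc n) * b \<in> ?Y"
      by (rule adjoinI[OF J'(4)[OF f(1) yb(2)] yb(3)])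
    moreover have "x \<in> A"
      unfolding yb(1) using yb(2,3) J'(1)[of y] by (simp add: add mult power f(1) del: power_Suc)
    ultimately show "x \<in> {x \<in> A. f * x \<in> ?Y}" using yb by (simp add: algebra_simps)
  qed
  moreover have "adjoin ?Y f = adjoin J f"
  proof (intro equalityI subsetI)
    fix x assume "x \<in> adjoin ?Y f"
    then obtain y b c where "x = y + f ^ Suc (Suc n) * b + f * c" "y \<in> J" "b \<in> A" "c \<in> A"
      by (auto simp: adjoin_def)
    moreover from this have "y + f * (f ^ Suc n * b + c) \<in> adjoin J f"
      by (intro adjoinI add mult power f(1))
    ultimately show "x \<in> adjoin J f" by (simp add: algebra_simps)
  next
    fix x assume "x \<in> adjoin J f"
    then obtain y b where yb: "x = y + f * b" "y \<in> J" "b \<in> A" by (auto simp: adjoin_def)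
    show "x \<in> adjoin ?Y f"
      unfolding yb(1) by (rule adjoinI[OF subsetD[OF subset_adjoin yb(2)] yb(3)])
  qed
  ultimately show ?case
    using Suc gs regular_extension[of ?Y f gs] is_ideal_adjoin[OF J power[OF f(1)]] f(1) by metis
qed

lemma regular_powers:
  assumes "is_ideal J" "regular J fs" "0 < n"
  shows "regular J (map (\<lambda>f. f ^ n) fs)"
  using assms
proof (induction fs arbitrary: J)
  case (Cons f fs)
  have f: "nonzerodivisor J f" "regular (adjoin J f) fs"
    using Cons.prems by auto
  have "regular (adjoin J (f ^ n)) fs"
    using regular_power_head[OF Cons.prems(1) f, of "n - 1"] Cons.prems(3) by simp
  then have "regular (adjoin J (f ^ n)) (map (\<lambda>f. f ^ n) fs)"
    using Cons.IH is_ideal_adjoin[OF Cons.prems(1) power[OF nonzerodivisorD(1)[OF f(1)]]] Cons.prems(3)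
    by blast
  then show ?case using nonzerodivisor_power[OF f(1)] by simp
qed simp

lemma power_product_closed: "set gs \<subseteq> A \<Longrightarrow> power_product gs ns \<in> A"
  by (induction gs ns rule: power_product.induct) (auto simp: one mult power)

text \<open>
  The analogue of algebraic independence for a regular sequence \<open>gs\<close>. The coefficients come from
  a family in which only zero multiplies \<open>u\<close> into the ideal generated by \<open>J\<close> and \<open>gs\<close>.
  In a relation sorted by powers of the first element \<open>g\<close>, a factor \<open>g\<^sup>n\<close> can be cancelled as long as
  all terms with smaller exponent vanish. Reducing modulo \<open>g\<close> then leaves a relation between the
  remaining elements, to which the induction hypothesis applies.
\<close>

lemma regular_monomials_independent:
  assumes "is_ideal J" "regular J gs" "u \<in> A"
    and "\<And>ns. a ns \<in> A" "\<And>ns. a ns * u \<in> foldl adjoin J gs \<Longrightarrow> a ns = 0"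
    and "(\<Sum>ns\<in>{ns. set ns \<subseteq> {..<B} \<and> length ns = length gs}. a ns * power_product gs ns) * u \<in> J"
    and "set ns \<subseteq> {..<B}" "length ns = length gs"
  shows "a ns = 0"
  using assms
proof (induction gs arbitrary: J a ns)
  case Nil
  have "{ns. set ns \<subseteq> {..<B} \<and> length ns = 0} = {[]}" by auto
  with Nil show ?case by simp
next
  case (Cons g gs)
  have nzd: "nonzerodivisor J g" and gs: "regular (adjoin J g) gs"
    using Cons.prems(2) by auto
  note g = nonzerodivisorD(1)[OF nzd] and gsA = regular_subset[OF gs]
  let ?E = "{ns. set ns \<subseteq> {..<B} \<and> length ns = length gs}"
  define F where "F n = (\<Sum>ns\<in>?E. a (n # ns) * power_product gs ns) * u" for n
  have F: "F n \<in> A" for n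
    unfolding F_def by (intro mult sum power_product_closed gsA Cons.prems)
  have step: "F n = 0 \<and> (\<forall>ns\<in>?E. a (n # ns) = 0)"
    if "n < B" "(\<Sum>k<B. g ^ k * F k) \<in> J" for n
    using that(1)
  proof (induction n rule: less_induct)
    case (less n)
    \<comment> \<open>The terms below \<open>n\<close> vanish, so \<open>g\<^sup>n\<close> is a common factor and can be cancelled.\<close>
    have "(\<Sum>k<B. g ^ k * F k) = (\<Sum>k\<in>{n..<B}. g ^ k * F k)"
      using less by (intro sum.mono_neutral_right) auto
    also have "\<dots> = g ^ n * F n + (\<Sum>k\<in>{Suc n..<B}. g ^ k * F k)"
      using less.prems by (simp add: sum.atLeast_Suc_lessThan)
    also have "(\<Sum>k\<in>{Suc n..<B}. g ^ k * F k) = g ^ n * (g * (\<Sum>k\<in>{Suc n..<B}. g ^ (k - Suc n) * F k))"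
    proof -
      have "g ^ k * F k = g ^ n * (g * (g ^ (k - Suc n) * F k))" if "k \<in> {Suc n..<B}" for k
      proof -
        have "g ^ k = g ^ (n + Suc (k - Suc n))" using that by simp
        also have "\<dots> = g ^ n * (g * g ^ (k - Suc n))" by (simp only: power_add power_Suc)
        finally show ?thesis by (simp add: mult.assoc)
      qed
      then show ?thesis by (simp add: sum_distrib_left)
    qed
    finally have eq: "(\<Sum>k<B. g ^ k * F k) = g ^ n * (F n + g * (\<Sum>k\<in>{Suc n..<B}. g ^ (k - Suc n) * F k))"
      by (simp add: algebra_simps)
    define R where "R = (\<Sum>k\<in>{Suc n..<B}. g ^ (k - Suc n) * F k)"
    have R: "R \<in> A" unfolding R_def by (intro sum mult power g F)
    have "g ^ n * (F n + g * R) \<in> J"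
      using that(2) unfolding eq R_def .
    then have "F n + g * R \<in> J"
      by (rule nonzerodivisorD(2)[OF nonzerodivisor_power[OF nzd] add[OF F mult[OF g R]]])
    from adjoinI[OF this minus[OF R], of g] have FJ: "F n \<in> adjoin J g" by simp
    have zero: "a (n # ns) = 0" if "ns \<in> ?E" for ns
    proof (rule Cons.IH[of "adjoin J g" "\<lambda>ns. a (n # ns)"])
      show "is_ideal (adjoin J g)" using Cons.prems(1) g by (rule is_ideal_adjoin)
      show "a (n # ns) = 0" if "a (n # ns) * u \<in> foldl adjoin (adjoin J g) gs" for ns
        using that Cons.prems(5) by simp
    qed (use that gs Cons.prems FJ in \<open>auto simp: F_def\<close>)
    then show ?case by (simp add: F_def)
  qed
  have "(\<Sum>k<B. g ^ k * F k) \<in> J"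
    using Cons.prems(6)
    by (simp add: sum_lists_Suc F_def sum_distrib_left sum_distrib_right algebra_simps)
  moreover obtain n ns' where "ns = n # ns'" "n < B" "ns' \<in> ?E"
    using Cons.prems(7,8) by (cases ns) auto
  ultimately show ?case using step by blast
qed

end

section \<open>Counting exponents against regular elements\<close>

lemma exponents_bounded_by:
  assumes "finite Z"
  shows "finite {m :: 'v \<Rightarrow>\<^sub>0 nat. Poly_Mapping.keys m \<subseteq> Z \<and> (\<forall>v. Poly_Mapping.lookup m v \<le> L)}" (is "finite ?Y")
    and "card {m :: 'v \<Rightarrow>\<^sub>0 nat. Poly_Mapping.keys m \<subseteq> Z \<and> (\<forall>v. Poly_Mapping.lookup m v \<le> L)} \<le> Suc L ^ card Z"
proof -
  let ?f = "\<lambda>m. restrict (Poly_Mapping.lookup m) Z"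
  have inj: "inj_on ?f ?Y"
  proof (rule inj_onI)
    fix m n assume mn: "m \<in> ?Y" "n \<in> ?Y" "?f m = ?f n"
    show "m = n"
    proof (rule poly_mapping_eqI)
      fix v
      show "Poly_Mapping.lookup m v = Poly_Mapping.lookup n v"
      proof (cases "v \<in> Z")
        case True
        then show ?thesis using fun_cong[OF mn(3), of v] by simp
      next
        case False
        then have "v \<notin> Poly_Mapping.keys m" "v \<notin> Poly_Mapping.keys n" using mn by auto
        then show ?thesis by (simp add: in_keys_iff)
      qed
    qed
  qed
  have sub: "?f ` ?Y \<subseteq> (\<Pi>\<^sub>E v\<in>Z. {..L})" by auto
  have fin: "finite (\<Pi>\<^sub>E v\<in>Z. {..L})" using assms by (intro finite_PiE) auto
  show "finite ?Y" using inj_on_finite[OF inj sub fin] .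
  show "card ?Y \<le> Suc L ^ card Z"
    using card_inj_on_le[OF inj sub fin] assms by (simp add: card_PiE)
qed

abbreviation exponents_le :: "nat \<Rightarrow> ('v, 'k::zero) mpoly \<Rightarrow> bool" where
  "exponents_le D \<equiv> supported (\<lambda>m. \<forall>v. Poly_Mapping.lookup m v \<le> D)"

lemma exponents_le_mult:
  fixes p q :: "('v, 'k::field) mpoly"
  assumes "exponents_le D p" "exponents_le E q"
  shows "exponents_le (D + E) (p * q)"
  using assms by (rule supported_mult) (simp add: lookup_add add_mono)

lemma exponents_le_power:
  fixes p :: "('v, 'k::field) mpoly"
  shows "exponents_le D p \<Longrightarrow> exponents_le (n * D) (p ^ n)"
  by (induction n) (auto simp: exponents_le_mult supported_def[of _ 1])

lemma exponents_le_exists: "\<exists>D. \<forall>p\<in>set ps. exponents_le D p"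
proof (induction ps)
  case (Cons p ps)
  then obtain D where D: "\<forall>p\<in>set ps. exponents_le D p" by blast
  define E where "E = (\<Sum>m\<in>Poly_Mapping.keys p. \<Sum>v\<in>Poly_Mapping.keys m. Poly_Mapping.lookup m v)"
  have "Poly_Mapping.lookup m v \<le> E" if m: "m \<in> Poly_Mapping.keys p" for m v
  proof (cases "v \<in> Poly_Mapping.keys m")
    case True
    then have "Poly_Mapping.lookup m v \<le> (\<Sum>v\<in>Poly_Mapping.keys m. Poly_Mapping.lookup m v)"
      by (intro member_le_sum) auto
    also have "\<dots> \<le> E" unfolding E_def using m by (intro member_le_sum) auto
    finally show ?thesis .
  qed (simp add: in_keys_iff)
  then have "exponents_le (max D E) p" by (auto simp: supported_def le_max_iff_disj)
  moreover have "\<forall>p\<in>set ps. exponents_le (max D E) p"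
    using D by (auto simp: le_max_iff_disj elim!: supported_mono)
  ultimately show ?case by (intro exI[of _ "max D E"]) simp
qed simp

lemma supported_deg_power:
  fixes p :: "('v, 'k::field) mpoly"
  assumes "supported (\<lambda>m. 1 \<le> (\<Sum>v\<in>V. Poly_Mapping.lookup m v)) p"
  shows "supported (\<lambda>m. n \<le> (\<Sum>v\<in>V. Poly_Mapping.lookup m v)) (p ^ n)"
proof (induction n)
  case 0 show ?case by (simp add: supported_def)
next
  case (Suc n)
  show ?case unfolding power_Suc
    using assms Suc by (rule supported_mult) (simp add: lookup_add sum.distrib)
qed

lemma lookup_const_mult:
  "Poly_Mapping.lookup (Poly_Mapping.single 0 c * p) m = (c :: 'k::field) * Poly_Mapping.lookup p m"
proof -
  have "Poly_Mapping.lookup (Poly_Mapping.map ((*) c) p) m = c * Poly_Mapping.lookup p m"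
    by (simp add: Poly_Mapping.map.rep_eq when_def)
  then show ?thesis by (simp add: mult_map_scale_conv_mult)
qed

interpretation poly: subring_set "carrier (poly_ring V :: ('v, 'k::field) mpoly ring)" for V
  by unfold_locales (fact poly_ring_closed)+

lemma ideal_imp_is_ideal:
  fixes V :: "'v set" and I :: "('v, 'k::field) mpoly set"
  assumes "ideal I (poly_ring V)"
  shows "poly.is_ideal V I"
proof -
  interpret ideal I "poly_ring V :: ('v, 'k) mpoly ring" by fact
  have "0 \<in> I" "\<And>x y. x \<in> I \<Longrightarrow> y \<in> I \<Longrightarrow> x + y \<in> I"
    using additive_subgroup.zero_closed[OF is_additive_subgroup]
      additive_subgroup.a_closed[OF is_additive_subgroup] by simp_all
  moreover have "a * x \<in> I" if "a \<in> carrier (poly_ring V)" "x \<in> I" for a x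
    using I_l_closed[OF that(2,1)] by simp
  ultimately show ?thesis
    unfolding poly.is_ideal_def using a_subset by blast
qed

lemma (in subring_set) foldl_adjoin_subset:
  "is_ideal T \<Longrightarrow> J \<subseteq> T \<Longrightarrow> set fs \<subseteq> T \<Longrightarrow> foldl adjoin J fs \<subseteq> T"
proof (induction fs arbitrary: J)
  case (Cons f fs)
  then have "adjoin J f \<subseteq> T" using is_idealD[OF Cons.prems(1)] by (auto simp: adjoin_def)
  with Cons show ?case by simp
qed simp

lemma (in subring_set) subset_foldl_adjoin: "J \<subseteq> foldl adjoin J fs"
proof (induction fs arbitrary: J)
  case (Cons f fs)
  then show ?case using subset_adjoin[of J f] by (auto intro: subset_trans)
qed simp

lemma (in subring_set) multiple_in_foldl_adjoin:
  "0 \<in> J \<Longrightarrow> f \<in> set fs \<Longrightarrow> y \<in> A \<Longrightarrow> f * y \<in> foldl adjoin J fs"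
proof (induction fs arbitrary: J)
  case (Cons g fs)
  show ?case
  proof (cases "f = g")
    case True
    have "0 + g * y \<in> adjoin J g" using Cons.prems by (intro adjoinI)
    then show ?thesis using True subsetD[OF subset_foldl_adjoin] by simp
  next
    case False
    then show ?thesis using Cons subsetD[OF subset_adjoin] by simp
  qed
qed simp

lemma exponents_le_power_product:
  fixes gs :: "('v, 'k::field) mpoly list"
  assumes "\<forall>g\<in>set gs. exponents_le D g" "set ns \<subseteq> {..<B}" "length ns = length gs"
  shows "exponents_le (length gs * (B * D)) (power_product gs ns)"
  using assms
proof (induction gs arbitrary: ns)
  case Nil
  then show ?case by (simp add: supported_def)
next
  case (Cons g gs)
  then obtain n ns' where ns: "ns = n # ns'" "n < B" by (cases ns) auto
  have "exponents_le (n * D + length gs * (B * D)) (power_product (g # gs) ns)"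
    using Cons ns by (auto intro!: exponents_le_mult exponents_le_power)
  moreover have "n * D \<le> B * D" using ns by simp
  then have "n * D + length gs * (B * D) \<le> length (g # gs) * (B * D)" by simp
  ultimately show ?case by (auto elim!: supported_mono intro: le_trans)
qed

text \<open>
  The bound by counting. Without constant terms, \<open>f\<^sup>q\<^sup>+\<^sup>1\<close> has only terms of degree above
  \<open>q\<close>, the degree of the monomial \<open>u\<close>; so no nonzero constant multiple of \<open>u\<close> is in the ideal generated
  by \<open>I\<close> and these powers. If \<open>t > q\<close> and \<open>B\<close> is large, there are more products of powers with exponents
  below \<open>B\<close> than monomials in the variables outside \<open>C\<close> that occur in them. A nontrivial linear
  combination \<open>p\<close> of the products therefore has only monomials that meet \<open>C\<close>, and \<open>p u \<in> I\<close>
  contradicts independence.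
\<close>

lemma regular_length_le:
  fixes V C :: "'v set" and I :: "('v, 'k::field) mpoly set"
  defines "u \<equiv> \<Prod>v\<in>V - C. mvar v"
  assumes V: "finite V" "C \<subseteq> V" and I: "ideal I (poly_ring V)"
    and I_supp: "\<And>p. p \<in> I \<Longrightarrow> meets C p"
    and u: "\<And>c. c \<in> C \<Longrightarrow> mvar c * u \<in> I"
    and fs: "poly.regular V I fs" "\<And>f. f \<in> set fs \<Longrightarrow> Poly_Mapping.lookup f 0 = 0"
  shows "length fs \<le> card (V - C)"
proof (rule ccontr)
  assume "\<not> length fs \<le> card (V - C)"
  define Z where "Z = V - C"
  define q where "q = card Z"
  define t where "t = length fs"
  define gs where "gs = map (\<lambda>f. f ^ Suc q) fs"
  define deg where "deg m = (\<Sum>v\<in>V. Poly_Mapping.lookup m v)" for m :: "'v \<Rightarrow>\<^sub>0 nat"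
  define mZ where "mZ = (\<Sum>v\<in>Z. Poly_Mapping.single v (1::nat))"
  let ?A = "carrier (poly_ring V :: ('v, 'k) mpoly ring)"
  have tq: "Suc q \<le> t" using \<open>\<not> _\<close> by (simp add: q_def t_def Z_def)
  have Z: "finite Z" "Z \<subseteq> V" using V by (auto simp: Z_def)
  note is_ideal = ideal_imp_is_ideal[OF I]
  have u_eq: "u = Poly_Mapping.single mZ 1"
    unfolding u_def Z_def[symmetric] mZ_def using Z by (rule_tac mvar_prod_eq_single)
  have keys_mZ: "Poly_Mapping.keys mZ = Z" unfolding mZ_def by (rule keys_sum_singles[OF Z(1)])
  have uA: "u \<in> ?A"
    using Z by (simp add: u_eq carrier_poly_ring supported_single keys_mZ)
  have "deg mZ = (\<Sum>v\<in>V. if v \<in> Z then 1 else 0)"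
    unfolding deg_def mZ_def using lookup_sum_singles[OF Z(1)] by simp
  then have deg_mZ: "deg mZ = q"
    using V(1) Z(2) by (simp add: q_def sum.If_cases Int_absorb1)
  have fsA: "set fs \<subseteq> ?A" using fs(1) by (rule poly.regular_subset)
  have gs: "poly.regular V I gs"
    unfolding gs_def using is_ideal fs(1) by (rule poly.regular_powers) simp
  have gsA: "set gs \<subseteq> ?A" using gs by (rule poly.regular_subset)
  have not_in: "c = 0" if "Poly_Mapping.single 0 c * u \<in> foldl (poly.adjoin V) I gs" for c
  proof -
    \<comment> \<open>Upward closed, satisfied by \<open>I\<close> and by the powers, but not by the monomial \<open>mZ\<close> of \<open>u\<close>.\<close>
    define Q where "Q m \<longleftrightarrow> Poly_Mapping.keys m \<inter> C \<noteq> {} \<or> Suc q \<le> deg m" for m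
    let ?T = "{p \<in> ?A. supported Q p}"
    have "ideal ?T (poly_ring V)"
      by (rule ideal_supported) (auto simp: Q_def keys_add_nat deg_def lookup_add sum.distrib)
    then have "poly.is_ideal V ?T" by (rule ideal_imp_is_ideal)
    moreover have "I \<subseteq> ?T"
    proof
      fix p assume p: "p \<in> I"
      have "supported Q p" using I_supp[OF p] by (rule supported_mono) (simp add: Q_def)
      with p show "p \<in> ?T" using poly.is_idealD(1)[OF is_ideal] by simp
    qed
    moreover have "set gs \<subseteq> ?T"
    proof
      fix g assume g: "g \<in> set gs"
      then obtain f where f: "f \<in> set fs" "g = f ^ Suc q" by (auto simp: gs_def)
      have "1 \<le> deg m" if m: "m \<in> Poly_Mapping.keys f" for m
      proof -
        have "m \<noteq> 0" using fs(2)[OF f(1)] m by (auto simp: in_keys_iff)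
        then obtain v where v: "Poly_Mapping.lookup m v \<noteq> 0"
          by (metis lookup_zero poly_mapping_eqI)
        moreover have "v \<in> V"
          using v m subsetD[OF fsA f(1)] unfolding carrier_poly_ring supported_def
          by (meson in_keys_iff subsetD)
        then have "Poly_Mapping.lookup m v \<le> deg m"
          unfolding deg_def using V(1) by (intro member_le_sum) auto
        ultimately show ?thesis by simp
      qed
      then have "supported (\<lambda>m. 1 \<le> deg m) f" by (simp add: supported_def)
      then have "supported (\<lambda>m. Suc q \<le> deg m) g"
        unfolding f(2) deg_def by (rule supported_deg_power)
      then show "g \<in> ?T" using g gsA by (auto simp: Q_def elim!: supported_mono)
    qed
    ultimately have "Poly_Mapping.single 0 c * u \<in> ?T"
      using poly.foldl_adjoin_subset that by blast
    then have "supported Q (Poly_Mapping.single mZ c)" by (simp add: u_eq mult_single)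
    moreover have "\<not> Q mZ" using keys_mZ deg_mZ by (auto simp: Q_def Z_def)
    ultimately show "c = 0" by (auto simp: supported_def split: if_splits)
  qed
  obtain D where D: "\<forall>g\<in>set gs. exponents_le D g" using exponents_le_exists by blast
  \<comment> \<open>Large enough that \<open>(B (tD + 1))\<^sup>q < B\<^sup>q\<^sup>+\<^sup>1\<close>; all exponents in the products are at most \<open>L\<close>.\<close>
  define B where "B = Suc (Suc (t * D) ^ q)"
  define L where "L = t * (B * D)"
  define E where "E = {ns. set ns \<subseteq> {..<B} \<and> length ns = t}"
  define Y where "Y = {m :: 'v \<Rightarrow>\<^sub>0 nat. Poly_Mapping.keys m \<subseteq> Z \<and> (\<forall>v. Poly_Mapping.lookup m v \<le> L)}"
  have "card Y \<le> Suc L ^ q" unfolding Y_def q_def by (rule exponents_bounded_by(2)[OF Z(1)])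
  also have "\<dots> \<le> (B * Suc (t * D)) ^ q"
    by (rule power_mono) (simp_all add: L_def B_def algebra_simps)
  also have "\<dots> = B ^ q * Suc (t * D) ^ q" by (rule power_mult_distrib)
  also have "\<dots> < B ^ q * B" by (simp add: B_def)
  also have "\<dots> = B ^ Suc q" by simp
  also have "\<dots> \<le> B ^ t" using tq by (intro power_increasing) (simp_all add: B_def)
  also have "\<dots> = card E" unfolding E_def by (simp add: card_lists_length_eq)
  finally have "card Y < card E" .
  moreover have "finite E" unfolding E_def by (simp add: finite_lists_length_eq)
  moreover have "finite Y" unfolding Y_def by (rule exponents_bounded_by(1)[OF Z(1)])
  ultimately obtain a ns0 where a: "ns0 \<in> E" "a ns0 \<noteq> 0"
    "\<And>m. m \<in> Y \<Longrightarrow> (\<Sum>ns\<in>E. a ns * Poly_Mapping.lookup (power_product gs ns) m) = 0"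
    using underdetermined_system_solvable[of Y E
        "\<lambda>ns m. Poly_Mapping.lookup (power_product gs ns) m"] by blast
  define p where "p = (\<Sum>ns\<in>E. Poly_Mapping.single 0 (a ns) * power_product gs ns)"
  have pA: "p \<in> ?A"
    unfolding p_def by (intro poly.sum poly.mult single_0_in_poly_ring poly.power_product_closed gsA)
  have pL: "exponents_le L p"
    unfolding p_def
  proof (rule supported_sum)
    fix ns assume "ns \<in> E"
    then have "exponents_le L (power_product gs ns)"
      unfolding E_def L_def using exponents_le_power_product[OF D, of ns B] by (simp add: t_def gs_def)
    then have "exponents_le (0 + L) (Poly_Mapping.single 0 (a ns) * power_product gs ns)"
      by (intro exponents_le_mult supported_single) auto
    then show "exponents_le L (Poly_Mapping.single 0 (a ns) * power_product gs ns)" by simp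
  qed
  have "meets C p"
    unfolding supported_def
  proof
    fix m assume m: "m \<in> Poly_Mapping.keys p"
    have "Poly_Mapping.lookup p m
        = (\<Sum>ns\<in>E. a ns * Poly_Mapping.lookup (power_product gs ns) m)"
      by (simp add: p_def lookup_sum lookup_const_mult)
    then have "m \<notin> Y" using m a(3) by (auto simp: in_keys_iff)
    then show "Poly_Mapping.keys m \<inter> C \<noteq> {}"
      using m pA pL by (auto simp: Y_def Z_def carrier_poly_ring supported_def)
  qed
  then have pu: "p * u \<in> I"
    using mult_in_ideal[OF I finite_subset[OF V(2,1)] V(2) uA u pA] by blast
  have "Poly_Mapping.single 0 (a ns0) = (0 :: ('v, 'k) mpoly)"
  proof (rule poly.regular_monomials_independent[OF is_ideal gs uA, where a = "\<lambda>ns. Poly_Mapping.single 0 (a ns)"])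
    show "(\<Sum>ns\<in>{ns. set ns \<subseteq> {..<B} \<and> length ns = length gs}.
        Poly_Mapping.single 0 (a ns) * power_product gs ns) * u \<in> I"
      using pu by (simp add: p_def E_def gs_def t_def)
    show "set ns0 \<subseteq> {..<B}" "length ns0 = length gs" using a(1) by (auto simp: E_def gs_def t_def)
    show "Poly_Mapping.single 0 (a ns) = (0 :: ('v, 'k) mpoly)"
      if "Poly_Mapping.single 0 (a ns) * u \<in> foldl (poly.adjoin V) I gs" for ns
      using not_in[OF that] by simp
  qed (simp add: single_0_in_poly_ring)
  then have "Poly_Mapping.lookup (Poly_Mapping.single (0 :: 'v \<Rightarrow>\<^sub>0 nat) (a ns0)) 0 = 0" by simp
  with a(2) show False by simp
qed

section \<open>Depth of a quotient of the polynomial ring\<close>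

lemma quot_module_simps:
  "carrier (quot_module R I) = a_rcosets\<^bsub>R\<^esub> I"
  "\<zero>\<^bsub>quot_module R I\<^esub> = I"
  "x \<oplus>\<^bsub>quot_module R I\<^esub> y = x <+>\<^bsub>R\<^esub> y"
  "a \<odot>\<^bsub>quot_module R I\<^esub> x = (I +>\<^bsub>R\<^esub> a) \<otimes>\<^bsub>R Quot I\<^esub> x"
  by (simp_all add: quot_module_def ring.extend_def FactRing_def)

context
  fixes R :: "'a ring" and I :: "'a set"
  assumes "cring R" "ideal I R"
begin

interpretation cring R by fact
interpretation ideal I R by fact

lemma quot_carrier: "carrier (quot_module R I) = {I +>\<^bsub>R\<^esub> x | x. x \<in> carrier R}"
  by (auto simp: quot_module_simps A_RCOSETS_def')

lemma quot_smult:
  "a \<in> carrier R \<Longrightarrow> x \<in> carrier R \<Longrightarrow> a \<odot>\<^bsub>quot_module R I\<^esub> (I +>\<^bsub>R\<^esub> x) = I +>\<^bsub>R\<^esub> (a \<otimes>\<^bsub>R\<^esub> x)"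
  by (simp add: quot_module_simps FactRing_def rcoset_mult_add)

lemma quot_add:
  "x \<in> carrier R \<Longrightarrow> y \<in> carrier R \<Longrightarrow>
     (I +>\<^bsub>R\<^esub> x) \<oplus>\<^bsub>quot_module R I\<^esub> (I +>\<^bsub>R\<^esub> y) = I +>\<^bsub>R\<^esub> (x \<oplus>\<^bsub>R\<^esub> y)"
  by (simp add: quot_module_simps a_rcos_sum)

lemma in_coset: "x \<in> carrier R \<Longrightarrow> x \<in> I +>\<^bsub>R\<^esub> x"
  by (rule a_rcos_self) (simp add: is_additive_subgroup)

lemma coset_eq_ideal_iff: "x \<in> carrier R \<Longrightarrow> I +>\<^bsub>R\<^esub> x = I \<longleftrightarrow> x \<in> I"
  using in_coset a_coset_join2 is_additive_subgroup a_rcos_const by blast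

lemma coset_image_submodule:
  assumes J: "ideal J R" "I \<subseteq> J"
  shows "submodule {I +>\<^bsub>R\<^esub> x | x. x \<in> J} R (quot_module R I)"
proof -
  interpret J: ideal J R by fact
  interpret Q: ring "R Quot I" by (rule quotient_is_ring)
  have simps: "carrier (quot_module R I) = carrier (R Quot I)" "\<zero>\<^bsub>quot_module R I\<^esub> = \<zero>\<^bsub>R Quot I\<^esub>"
    "(\<oplus>\<^bsub>quot_module R I\<^esub>) = (\<oplus>\<^bsub>R Quot I\<^esub>)"
    by (simp_all add: quot_module_def ring.extend_def)
  interpret M: abelian_group "quot_module R I"
  proof (rule abelian_groupI)
    fix x assume "x \<in> carrier (quot_module R I)"
    then show "\<exists>y\<in>carrier (quot_module R I). y \<oplus>\<^bsub>quot_module R I\<^esub> x = \<zero>\<^bsub>quot_module R I\<^esub>"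
      unfolding simps using Q.l_neg Q.a_inv_closed by blast
  qed (simp_all only: simps Q.add.m_closed Q.zero_closed Q.a_assoc Q.l_zero, rule Q.a_comm)
  have "subgroup {I +>\<^bsub>R\<^esub> x | x. x \<in> J} (add_monoid (quot_module R I))"
  proof (rule group.subgroupI[OF M.a_group])
    show "{I +>\<^bsub>R\<^esub> x | x. x \<in> J} \<subseteq> carrier (add_monoid (quot_module R I))"
      using J.a_subset by (auto simp: quot_carrier)
    show "{I +>\<^bsub>R\<^esub> x | x. x \<in> J} \<noteq> {}" using J.zero_closed by blast
  next
    fix X assume "X \<in> {I +>\<^bsub>R\<^esub> x | x. x \<in> J}"
    then obtain x where x: "x \<in> J" "X = I +>\<^bsub>R\<^esub> x" by blast
    have xR: "x \<in> carrier R" using x J.a_subset by blast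
    have "(I +>\<^bsub>R\<^esub> (\<ominus>\<^bsub>R\<^esub> x)) \<oplus>\<^bsub>quot_module R I\<^esub> X = I +>\<^bsub>R\<^esub> (\<ominus>\<^bsub>R\<^esub> x \<oplus>\<^bsub>R\<^esub> x)"
      unfolding x(2) using xR by (intro quot_add) auto
    also have "\<dots> = I" using xR l_neg coset_eq_ideal_iff[of "\<zero>\<^bsub>R\<^esub>"] zero_closed by simp
    finally have "\<ominus>\<^bsub>quot_module R I\<^esub> X = I +>\<^bsub>R\<^esub> (\<ominus>\<^bsub>R\<^esub> x)"
      using xR x(2) by (intro M.minus_equality) (auto simp: quot_carrier quot_module_simps(2))
    then show "inv\<^bsub>add_monoid (quot_module R I)\<^esub> X \<in> {I +>\<^bsub>R\<^esub> x | x. x \<in> J}"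
      using J.a_inv_closed[OF x(1)] by (auto simp: a_inv_def)
  next
    fix X Y assume "X \<in> {I +>\<^bsub>R\<^esub> x | x. x \<in> J}" "Y \<in> {I +>\<^bsub>R\<^esub> x | x. x \<in> J}"
    then obtain x y where xy: "x \<in> J" "X = I +>\<^bsub>R\<^esub> x" "y \<in> J" "Y = I +>\<^bsub>R\<^esub> y" by blast
    then have "X \<oplus>\<^bsub>quot_module R I\<^esub> Y = I +>\<^bsub>R\<^esub> (x \<oplus>\<^bsub>R\<^esub> y)"
      using J.a_subset quot_add by blast
    then show "X \<otimes>\<^bsub>add_monoid (quot_module R I)\<^esub> Y \<in> {I +>\<^bsub>R\<^esub> x | x. x \<in> J}"
      using xy J.a_closed by auto
  qed
  moreover have "a \<odot>\<^bsub>quot_module R I\<^esub> X \<in> {I +>\<^bsub>R\<^esub> x | x. x \<in> J}"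
    if "a \<in> carrier R" "X \<in> {I +>\<^bsub>R\<^esub> x | x. x \<in> J}" for a X
    using that J.a_subset J.I_l_closed by (fastforce simp: quot_smult)
  ultimately show ?thesis
    by (simp add: submodule_def submodule_axioms_def)
qed

end

lemma is_ideal_imp_ideal:
  fixes J :: "('v, 'k::field) mpoly set"
  assumes "poly.is_ideal V J"
  shows "ideal J (poly_ring V)"
proof -
  interpret cring "poly_ring V :: ('v, 'k) mpoly ring" by (rule cring_poly_ring)
  note J = poly.is_idealD[OF assms]
  have inv: "\<ominus>\<^bsub>poly_ring V\<^esub> p = - p" if "p \<in> carrier (poly_ring V)" for p :: "('v, 'k) mpoly"
    using that by (intro minus_equality) (auto simp: poly_ring_closed)
  have "inv\<^bsub>add_monoid (poly_ring V)\<^esub> x \<in> J" if "x \<in> J" for x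
    using J(6)[OF J(2) that] inv[OF J(1)[OF that]] by (simp add: a_inv_def)
  then have "subgroup J (add_monoid (poly_ring V))"
    by (intro group.subgroupI[OF a_group]) (auto intro: J(1,3) simp: ex_in_conv[symmetric] intro!: exI[of _ 0] J(2))
  then show ?thesis
    by (rule idealI[OF ring_axioms]) (auto intro: J(4,5))
qed

text \<open>
  The submodule \<open>(fs)(S/I)\<close> corresponds to the ideal generated by \<open>I\<close> and \<open>fs\<close>. This is what
  translates regularity on the module \<open>S/I\<close> into regularity modulo an ideal.
\<close>

lemma coset_in_ideal_smult_iff:
  fixes I :: "('v, 'k::field) mpoly set"
  assumes I: "ideal I (poly_ring V)" and fs: "set fs \<subseteq> carrier (poly_ring V)"
    and x: "x \<in> carrier (poly_ring V)"
  shows "I +>\<^bsub>poly_ring V\<^esub> x \<in> ideal_smult (poly_ring V) (set fs) (quot_module (poly_ring V) I)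
     \<longleftrightarrow> x \<in> foldl (poly.adjoin V) I fs"
proof
  let ?S = "poly_ring V :: ('v, 'k) mpoly ring" and ?J = "foldl (poly.adjoin V) I fs"
  let ?M = "quot_module ?S I"
  note Q = cring_poly_ring I
  have sub: "J \<subseteq> foldl (poly.adjoin V) J gs" for J and gs :: "('v, 'k) mpoly list"
    by (rule poly.subset_foldl_adjoin)
  have J: "ideal ?J ?S"
    using poly.is_ideal_foldl[OF ideal_imp_is_ideal[OF I] fs] by (rule is_ideal_imp_ideal)
  assume "I +>\<^bsub>?S\<^esub> x \<in> ideal_smult ?S (set fs) ?M"
  moreover have mult: "a \<odot>\<^bsub>?M\<^esub> X \<in> {I +>\<^bsub>?S\<^esub> y | y. y \<in> ?J}"
    if a: "a \<in> set fs" and X: "X \<in> carrier ?M" for a X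
  proof -
    obtain y where y: "y \<in> carrier ?S" "X = I +>\<^bsub>?S\<^esub> y" using X by (auto simp: quot_carrier[OF Q])
    have "a * y \<in> ?J"
      by (rule poly.multiple_in_foldl_adjoin[OF poly.is_idealD(2)[OF ideal_imp_is_ideal[OF I]] a y(1)])
    moreover have "a \<odot>\<^bsub>?M\<^esub> X = I +>\<^bsub>?S\<^esub> (a * y)"
      using a fs y by (auto simp: quot_smult[OF Q])
    ultimately show ?thesis by blast
  qed
  moreover have "ideal_smult ?S (set fs) ?M \<subseteq> {I +>\<^bsub>?S\<^esub> y | y. y \<in> ?J}"
    unfolding ideal_smult_def
    by (rule Inter_lower) (use coset_image_submodule[OF Q J sub] mult in simp)
  ultimately have "I +>\<^bsub>?S\<^esub> x \<in> {I +>\<^bsub>?S\<^esub> y | y. y \<in> ?J}" by blast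
  then obtain y where y: "y \<in> ?J" "I +>\<^bsub>?S\<^esub> x = I +>\<^bsub>?S\<^esub> y" by blast
  have "x \<in> I +>\<^bsub>?S\<^esub> y" using in_coset[OF Q x] y by simp
  then obtain i where i: "i \<in> I" "x = i + y" by (auto simp: a_r_coset_def')
  show "x \<in> ?J"
    unfolding i(2) by (rule poly.is_idealD(3)[OF ideal_imp_is_ideal[OF J] subsetD[OF sub i(1)] y(1)])
next
  let ?S = "poly_ring V :: ('v, 'k) mpoly ring"
  let ?M = "quot_module ?S I"
  note Q = cring_poly_ring I
  assume xJ: "x \<in> foldl (poly.adjoin V) I fs"
  show "I +>\<^bsub>?S\<^esub> x \<in> ideal_smult ?S (set fs) ?M"
    unfolding ideal_smult_def
  proof (intro InterI)
    fix N assume "N \<in> {N. submodule N ?S ?M \<and> (\<forall>a\<in>set fs. \<forall>x\<in>carrier ?M. a \<odot>\<^bsub>?M\<^esub> x \<in> N)}"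
    then have N: "submodule N ?S ?M" "\<And>a X. a \<in> set fs \<Longrightarrow> X \<in> carrier ?M \<Longrightarrow> a \<odot>\<^bsub>?M\<^esub> X \<in> N"
      by auto
    have sg: "subgroup N (add_monoid ?M)" using N(1) by (rule submodule.axioms(1))
    have base: "\<forall>x\<in>I. I +>\<^bsub>?S\<^esub> x \<in> N"
    proof
      fix x assume "x \<in> I"
      then have "I +>\<^bsub>?S\<^esub> x = I"
        using coset_eq_ideal_iff[OF Q] poly.is_idealD(1)[OF ideal_imp_is_ideal[OF I]] by blast
      moreover have "I \<in> N" using subgroup.one_closed[OF sg] by (simp add: quot_module_simps)
      ultimately show "I +>\<^bsub>?S\<^esub> x \<in> N" by simp
    qed
    have "\<forall>x\<in>foldl (poly.adjoin V) J gs. I +>\<^bsub>?S\<^esub> x \<in> N"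
      if "set gs \<subseteq> set fs" "J \<subseteq> carrier ?S" "\<forall>x\<in>J. I +>\<^bsub>?S\<^esub> x \<in> N" for gs J
      using that
    proof (induction gs arbitrary: J)
      case (Cons g gs)
      have "I +>\<^bsub>?S\<^esub> y \<in> N" "y \<in> carrier ?S" if y: "y \<in> poly.adjoin V J g" for y
      proof -
        obtain z b where zb: "y = z + g * b" "z \<in> J" "b \<in> carrier ?S"
          using y by (auto simp: poly.adjoin_def)
        have mem: "z \<in> carrier ?S" "g \<in> carrier ?S" using zb Cons.prems fs by auto
        then show "y \<in> carrier ?S" using zb by (simp add: poly_ring_closed)
        have "g \<odot>\<^bsub>?M\<^esub> (I +>\<^bsub>?S\<^esub> b) \<in> N"
          using Cons.prems(1) zb(3) by (intro N(2)) (auto simp: quot_carrier[OF Q])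
        then have "I +>\<^bsub>?S\<^esub> (g * b) \<in> N" using quot_smult[OF Q mem(2) zb(3)] by simp
        then have "(I +>\<^bsub>?S\<^esub> z) \<oplus>\<^bsub>?M\<^esub> (I +>\<^bsub>?S\<^esub> (g * b)) \<in> N"
          using subgroup.m_closed[OF sg, of "I +>\<^bsub>?S\<^esub> z"] Cons.prems(3) zb(2) by simp
        then show "I +>\<^bsub>?S\<^esub> y \<in> N"
          using quot_add[OF Q mem(1), of "g * b"] mem zb by (simp add: poly_ring_closed)
      qed
      then have "poly.adjoin V J g \<subseteq> carrier ?S" "\<forall>y\<in>poly.adjoin V J g. I +>\<^bsub>?S\<^esub> y \<in> N"
        by blast+
      with Cons.prems(1) show ?case
        unfolding foldl.simps by (intro Cons.IH) auto
    qed simp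
    moreover have "I \<subseteq> carrier ?S" using poly.is_idealD(1)[OF ideal_imp_is_ideal[OF I]] by blast
    ultimately show "I +>\<^bsub>?S\<^esub> x \<in> N" using xJ base by blast
  qed
qed

lemma (in subring_set) regular_nthI:
  "(\<And>i. i < length fs \<Longrightarrow> nonzerodivisor (foldl adjoin J (take i fs)) (fs ! i)) \<Longrightarrow> regular J fs"
proof (induction fs arbitrary: J)
  case (Cons f fs)
  have "nonzerodivisor J f" using Cons.prems[of 0] by simp
  moreover have "regular (adjoin J f) fs" using Cons.prems[of "Suc _"] by (intro Cons.IH) auto
  ultimately show ?case by simp
qed simp

lemma regular_sequence_imp_regular:
  fixes I :: "('v, 'k::field) mpoly set"
  assumes I: "ideal I (poly_ring V)" and "regular_sequence (poly_ring V) (quot_module (poly_ring V) I) fs"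
  shows "poly.regular V I fs"
proof (rule poly.regular_nthI)
  let ?S = "poly_ring V :: ('v, 'k) mpoly ring"
  let ?M = "quot_module ?S I"
  note Q = cring_poly_ring I
  fix i assume i: "i < length fs"
  have fs: "set fs \<subseteq> carrier ?S" and
    reg: "\<And>m. m \<in> carrier ?M \<Longrightarrow> (fs ! i) \<odot>\<^bsub>?M\<^esub> m \<in> ideal_smult ?S (set (take i fs)) ?M \<Longrightarrow>
        m \<in> ideal_smult ?S (set (take i fs)) ?M"
    using assms(2) i unfolding regular_sequence_def by blast+
  have take: "set (take i fs) \<subseteq> carrier ?S" using fs set_take_subset by fastforce
  have f: "fs ! i \<in> carrier ?S" using fs i by auto
  have "x \<in> foldl (poly.adjoin V) I (take i fs)"
    if x: "x \<in> carrier ?S" "fs ! i * x \<in> foldl (poly.adjoin V) I (take i fs)" for x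
  proof -
    have "(fs ! i) \<odot>\<^bsub>?M\<^esub> (I +>\<^bsub>?S\<^esub> x) = I +>\<^bsub>?S\<^esub> (fs ! i * x)"
      using quot_smult[OF Q f x(1)] by simp
    also have "\<dots> \<in> ideal_smult ?S (set (take i fs)) ?M"
      using coset_in_ideal_smult_iff[OF I take] x f by (simp add: poly_ring_closed)
    finally have "I +>\<^bsub>?S\<^esub> x \<in> ideal_smult ?S (set (take i fs)) ?M"
      by (rule reg[rotated]) (use x(1) in \<open>auto simp: quot_carrier[OF Q]\<close>)
    then show ?thesis using coset_in_ideal_smult_iff[OF I take x(1)] by simp
  qed
  with f show "poly.nonzerodivisor V (foldl (poly.adjoin V) I (take i fs)) (fs ! i)"
    by (simp add: poly.nonzerodivisor_def)
qed

lemma irrelevant_ideal_lookup_zero: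
  assumes "p \<in> (irrelevant_ideal V :: ('v, 'k::field) mpoly set)"
  shows "Poly_Mapping.lookup p 0 = 0"
proof -
  interpret cring "poly_ring V :: ('v, 'k) mpoly ring" by (rule cring_poly_ring)
  have "irrelevant_ideal V \<subseteq> {p \<in> carrier (poly_ring V :: ('v, 'k) mpoly ring).
      supported (\<lambda>m. Poly_Mapping.keys m \<noteq> {}) p}"
    unfolding irrelevant_ideal_def
    by (rule genideal_minimal[OF ideal_supported]) (auto simp: keys_add_nat mvar_in_poly_ring intro!: supported_mvar simp del: keys_eq_empty)
  then have "0 \<notin> Poly_Mapping.keys p" using assms by (auto simp: supported_def)
  then show ?thesis by (simp add: in_keys_iff)
qed

theorem depth_le:
  fixes V C :: "'v set" and I :: "('v, 'k::field) mpoly set"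
  assumes "finite V" "C \<subseteq> V" "ideal I (poly_ring V)"
    and "\<And>p. p \<in> I \<Longrightarrow> meets C p"
    and "\<And>c. c \<in> C \<Longrightarrow> mvar c * (\<Prod>v\<in>V - C. mvar v) \<in> I"
  shows "depth (poly_ring V) (irrelevant_ideal V) (quot_module (poly_ring V) I) \<le> enat (card (V - C))"
  unfolding depth_def
proof (rule Sup_least)
  fix l assume "l \<in> {enat (length xs) |xs. set xs \<subseteq> (irrelevant_ideal V :: ('v, 'k) mpoly set) \<and>
      regular_sequence (poly_ring V) (quot_module (poly_ring V) I) xs}"
  then obtain xs where xs: "l = enat (length xs)" "set xs \<subseteq> (irrelevant_ideal V :: ('v, 'k) mpoly set)"
    "regular_sequence (poly_ring V) (quot_module (poly_ring V) I) xs" by blast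
  have "length xs \<le> card (V - C)"
    using regular_sequence_imp_regular[OF assms(3) xs(3)] xs(2) irrelevant_ideal_lookup_zero assms
    by (intro regular_length_le[of V C I xs]) auto
  then show "l \<le> enat (card (V - C))" by (simp add: xs(1))
qed

text \<open>
  The submodule \<open>(cs)M\<close>. The recursion adds the new element at the head, so a list and its tails are
  the initial segments of the sequence, in reverse order.
\<close>

section \<open>Weakly regular sequences on modules\<close>

fun seq_span :: "('a, 'b, 'm) module_scheme \<Rightarrow> 'a list \<Rightarrow> 'b set" where
  "seq_span M [] = {\<zero>\<^bsub>M\<^esub>}"
| "seq_span M (c # cs) = {x \<oplus>\<^bsub>M\<^esub> c \<odot>\<^bsub>M\<^esub> y | x y. x \<in> seq_span M cs \<and> y \<in> carrier M}"

fun weakly_regular :: "('a, 'b, 'm) module_scheme \<Rightarrow> 'a list \<Rightarrow> bool" where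
  "weakly_regular M [] \<longleftrightarrow> True"
| "weakly_regular M (c # cs) \<longleftrightarrow> weakly_regular M cs \<and>
     (\<forall>x\<in>carrier M. c \<odot>\<^bsub>M\<^esub> x \<in> seq_span M cs \<longrightarrow> x \<in> seq_span M cs)"

context Module.module
begin

lemma seq_span_closed: "set cs \<subseteq> carrier R \<Longrightarrow> x \<in> seq_span M cs \<Longrightarrow> x \<in> carrier M"
  by (induction cs arbitrary: x) auto

lemma seq_span_ConsI: "x \<in> seq_span M cs \<Longrightarrow> y \<in> carrier M \<Longrightarrow> x \<oplus>\<^bsub>M\<^esub> c \<odot>\<^bsub>M\<^esub> y \<in> seq_span M (c # cs)"
  by auto

lemma seq_span_zero: "set cs \<subseteq> carrier R \<Longrightarrow> \<zero>\<^bsub>M\<^esub> \<in> seq_span M cs"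
proof (induction cs)
  case (Cons c cs)
  then have "\<zero>\<^bsub>M\<^esub> \<oplus>\<^bsub>M\<^esub> c \<odot>\<^bsub>M\<^esub> \<zero>\<^bsub>M\<^esub> \<in> seq_span M (c # cs)" by (intro seq_span_ConsI) auto
  with Cons show ?case by simp
qed simp

lemma seq_span_add:
  "set cs \<subseteq> carrier R \<Longrightarrow> x \<in> seq_span M cs \<Longrightarrow> y \<in> seq_span M cs \<Longrightarrow> x \<oplus>\<^bsub>M\<^esub> y \<in> seq_span M cs"
proof (induction cs arbitrary: x y)
  case (Cons c cs)
  then obtain x' a y' b where eq: "x = x' \<oplus>\<^bsub>M\<^esub> c \<odot>\<^bsub>M\<^esub> a" "y = y' \<oplus>\<^bsub>M\<^esub> c \<odot>\<^bsub>M\<^esub> b"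
    and mem: "x' \<in> seq_span M cs" "y' \<in> seq_span M cs" "a \<in> carrier M" "b \<in> carrier M"
    by auto
  have cs: "set cs \<subseteq> carrier R" and c: "c \<in> carrier R" using Cons.prems(1) by auto
  note xy = seq_span_closed[OF cs mem(1)] seq_span_closed[OF cs mem(2)]
  then have "x \<oplus>\<^bsub>M\<^esub> y = (x' \<oplus>\<^bsub>M\<^esub> y') \<oplus>\<^bsub>M\<^esub> c \<odot>\<^bsub>M\<^esub> (a \<oplus>\<^bsub>M\<^esub> b)"
    unfolding eq using mem(3,4) c by (simp add: smult_r_distr M.a_ac)
  also have "\<dots> \<in> seq_span M (c # cs)"
    using mem(3,4) by (intro seq_span_ConsI Cons.IH[OF cs mem(1,2)] M.a_closed)
  finally show ?case .
qed simp

lemma seq_span_smult: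
  "set cs \<subseteq> carrier R \<Longrightarrow> a \<in> carrier R \<Longrightarrow> x \<in> seq_span M cs \<Longrightarrow> a \<odot>\<^bsub>M\<^esub> x \<in> seq_span M cs"
proof (induction cs arbitrary: x)
  case (Cons c cs)
  then obtain x' b where eq: "x = x' \<oplus>\<^bsub>M\<^esub> c \<odot>\<^bsub>M\<^esub> b" and mem: "x' \<in> seq_span M cs" "b \<in> carrier M"
    by auto
  have cs: "set cs \<subseteq> carrier R" and c: "c \<in> carrier R" using Cons.prems(1) by auto
  note x' = seq_span_closed[OF cs mem(1)]
  then have "a \<odot>\<^bsub>M\<^esub> x = a \<odot>\<^bsub>M\<^esub> x' \<oplus>\<^bsub>M\<^esub> c \<odot>\<^bsub>M\<^esub> (a \<odot>\<^bsub>M\<^esub> b)"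
    unfolding eq using mem(2) c Cons.prems(2)
    by (simp add: smult_r_distr smult_assoc1[symmetric] R.m_comm)
  also have "\<dots> \<in> seq_span M (c # cs)"
    using mem(2) Cons.prems(2) by (intro seq_span_ConsI Cons.IH[OF cs _ mem(1)] smult_closed)
  finally show ?case .
qed simp

lemma minus_eq_smult: "x \<in> carrier M \<Longrightarrow> \<ominus>\<^bsub>M\<^esub> x = (\<ominus>\<^bsub>R\<^esub> \<one>\<^bsub>R\<^esub>) \<odot>\<^bsub>M\<^esub> x"
  by (simp add: smult_l_minus)

lemma seq_span_minus:
  "set cs \<subseteq> carrier R \<Longrightarrow> x \<in> seq_span M cs \<Longrightarrow> \<ominus>\<^bsub>M\<^esub> x \<in> seq_span M cs"
  using seq_span_smult[of cs "\<ominus>\<^bsub>R\<^esub> \<one>\<^bsub>R\<^esub>" x] by (simp add: minus_eq_smult seq_span_closed)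

end

lemma mod_homD:
  assumes "f \<in> mod_hom R M N"
  shows "x \<in> carrier M \<Longrightarrow> f x \<in> carrier N"
    and "x \<in> carrier M \<Longrightarrow> y \<in> carrier M \<Longrightarrow> f (x \<oplus>\<^bsub>M\<^esub> y) = f x \<oplus>\<^bsub>N\<^esub> f y"
    and "a \<in> carrier R \<Longrightarrow> x \<in> carrier M \<Longrightarrow> f (a \<odot>\<^bsub>M\<^esub> x) = a \<odot>\<^bsub>N\<^esub> f x"
  using assms by (auto simp: mod_hom_def)

lemma mod_hom_zero:
  assumes "Module.module R M" "Module.module R N" "f \<in> mod_hom R M N"
  shows "f \<zero>\<^bsub>M\<^esub> = \<zero>\<^bsub>N\<^esub>"
proof -
  interpret M: Module.module R M by fact
  interpret N: Module.module R N by fact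
  have "f (\<zero>\<^bsub>R\<^esub> \<odot>\<^bsub>M\<^esub> \<zero>\<^bsub>M\<^esub>) = \<zero>\<^bsub>R\<^esub> \<odot>\<^bsub>N\<^esub> f \<zero>\<^bsub>M\<^esub>"
    by (rule mod_homD(3)[OF assms(3)]) simp_all
  then show ?thesis using mod_homD(1)[OF assms(3)] by simp
qed

lemma mod_hom_minus:
  assumes "Module.module R M" "Module.module R N" "f \<in> mod_hom R M N" "x \<in> carrier M"
  shows "f (\<ominus>\<^bsub>M\<^esub> x) = \<ominus>\<^bsub>N\<^esub> f x"
proof -
  interpret M: Module.module R M by fact
  interpret N: Module.module R N by fact
  show ?thesis
    using mod_homD(3)[OF assms(3) _ assms(4), of "\<ominus>\<^bsub>R\<^esub> \<one>\<^bsub>R\<^esub>"] mod_homD(1)[OF assms(3,4)] assms(4)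
    by (simp add: M.minus_eq_smult N.minus_eq_smult)
qed

lemma mod_hom_seq_span:
  assumes "Module.module R M" "Module.module R N" "f \<in> mod_hom R M N" "set cs \<subseteq> carrier R" "x \<in> seq_span M cs"
  shows "f x \<in> seq_span N cs"
  using assms(4,5)
proof (induction cs arbitrary: x)
  case Nil
  then show ?case using mod_hom_zero[OF assms(1-3)] by simp
next
  case (Cons c cs)
  then obtain x' b where eq: "x = x' \<oplus>\<^bsub>M\<^esub> c \<odot>\<^bsub>M\<^esub> b" and mem: "x' \<in> seq_span M cs" "b \<in> carrier M"
    by auto
  note h = mod_homD[OF assms(3)]
  have cs: "set cs \<subseteq> carrier R" and c: "c \<in> carrier R" using Cons.prems(1) by auto
  have "f x = f x' \<oplus>\<^bsub>N\<^esub> f (c \<odot>\<^bsub>M\<^esub> b)"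
    unfolding eq using module.seq_span_closed[OF assms(1) cs mem(1)]
      Module.module.smult_closed[OF assms(1) c mem(2)] by (rule h(2))
  also have "\<dots> = f x' \<oplus>\<^bsub>N\<^esub> c \<odot>\<^bsub>N\<^esub> f b" using h(3)[OF c mem(2)] by simp
  also have "\<dots> \<in> seq_span N (c # cs)"
    by (intro module.seq_span_ConsI[OF assms(2)] Cons.IH[OF cs mem(1)] h(1)[OF mem(2)])
  finally show ?case .
qed

text \<open>
  The section \<open>s\<close> carries a relation from \<open>M\<close> to \<open>N\<close>, where regularity applies, and the retraction
  \<open>p\<close> carries the result back.
\<close>

lemma weakly_regular_summand:
  assumes M: "Module.module R M" and N: "Module.module R N" and s: "s \<in> mod_hom R M N" and p: "p \<in> mod_hom R N M"
    and ps: "\<And>x. x \<in> carrier M \<Longrightarrow> p (s x) = x"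
    and cs: "set cs \<subseteq> carrier R" "weakly_regular N cs"
  shows "weakly_regular M cs"
  using cs
proof (induction cs)
  case (Cons c cs)
  have cR: "set cs \<subseteq> carrier R" and c: "c \<in> carrier R" using Cons.prems(1) by auto
  have "x \<in> seq_span M cs" if x: "x \<in> carrier M" "c \<odot>\<^bsub>M\<^esub> x \<in> seq_span M cs" for x
  proof -
    have "c \<odot>\<^bsub>N\<^esub> s x \<in> seq_span N cs"
      using mod_hom_seq_span[OF M N s cR x(2)] unfolding mod_homD(3)[OF s c x(1)] .
    then have "s x \<in> seq_span N cs"
      using Cons.prems(2) mod_homD(1)[OF s x(1)] unfolding weakly_regular.simps by blast
    from mod_hom_seq_span[OF N M p cR this] show ?thesis unfolding ps[OF x(1)] .
  qed
  with Cons.IH[OF cR] Cons.prems(2) show ?case unfolding weakly_regular.simps by blast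
qed simp

text \<open>
  A resolution without its augmentation: the resolved module is the cokernel of \<open>d 0\<close>.
\<close>

section \<open>Chasing a socle element through a resolution\<close>

locale module_complex =
  fixes R :: "'a ring" and P :: "nat \<Rightarrow> ('a, 'c) module" and d :: "nat \<Rightarrow> 'c \<Rightarrow> 'c"
  assumes mod: "\<And>i. Module.module R (P i)"
    and hom: "\<And>i. d i \<in> mod_hom R (P (Suc i)) (P i)"
    and exact: "\<And>i. d (Suc i) ` carrier (P (Suc (Suc i))) = mod_ker (P (Suc i)) (P i) (d i)"
begin

lemma d_d: "x \<in> carrier (P (Suc (Suc i))) \<Longrightarrow> d i (d (Suc i) x) = \<zero>\<^bsub>P i\<^esub>"
  using exact[of i] by (auto simp: mod_ker_def)

text \<open>
  Killing one nonzerodivisor \<open>c\<close> costs one degree of exactness: if \<open>d x\<close> vanishes modulo \<open>c\<close> and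
  \<open>cs\<close>, say \<open>d x = a + c y\<close>, then \<open>c d y\<close> and hence \<open>d y\<close> vanishes modulo \<open>cs\<close>. So
  \<open>y\<close> is a boundary \<open>d w\<close> modulo \<open>cs\<close>, and \<open>x - c w\<close> is a cycle modulo \<open>cs\<close>.
\<close>

lemma exact_modulo:
  assumes "set cs \<subseteq> carrier R" "\<And>i. weakly_regular (P i) cs" "length cs \<le> i"
    and "x \<in> carrier (P (Suc i))" "d i x \<in> seq_span (P i) cs"
  shows "\<exists>w\<in>carrier (P (Suc (Suc i))). \<exists>z\<in>seq_span (P (Suc i)) cs. x = d (Suc i) w \<oplus>\<^bsub>P (Suc i)\<^esub> z"
  using assms
proof (induction cs arbitrary: i x)
  case Nil
  interpret Module.module R "P (Suc i)" by (rule mod)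
  have "x \<in> mod_ker (P (Suc i)) (P i) (d i)" using Nil by (simp add: mod_ker_def)
  then obtain w where w: "w \<in> carrier (P (Suc (Suc i)))" "x = d (Suc i) w"
    unfolding exact[symmetric] by blast
  have "x = d (Suc i) w \<oplus>\<^bsub>P (Suc i)\<^esub> \<zero>\<^bsub>P (Suc i)\<^esub>" using w(2) Nil.prems(4) by simp
  then show ?case unfolding seq_span.simps using w(1) by blast
next
  case (Cons c cs)
  obtain j where j: "i = Suc j" "length cs \<le> j" using Cons.prems(3) by (cases i) auto
  interpret Pj: Module.module R "P j" by (rule mod)
  interpret Pi: Module.module R "P i" by (rule mod)
  interpret Ps: Module.module R "P (Suc i)" by (rule mod)
  note hj = mod_homD[OF hom[of j], folded j(1)] and hi = mod_homD[OF hom[of i]]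
  have c: "c \<in> carrier R" and cs: "set cs \<subseteq> carrier R" using Cons.prems by auto
  have reg: "\<And>i. weakly_regular (P i) cs" using Cons.prems(2) by (meson weakly_regular.simps(2))
  obtain a y where ay: "d i x = a \<oplus>\<^bsub>P i\<^esub> c \<odot>\<^bsub>P i\<^esub> y" "a \<in> seq_span (P i) cs" "y \<in> carrier (P i)"
    using Cons.prems(5) by auto
  have aP: "a \<in> carrier (P i)" using Pi.seq_span_closed[OF cs ay(2)] .
  have "\<zero>\<^bsub>P j\<^esub> = d j (d i x)" using d_d[of x j] Cons.prems(4) j(1) by simp
  also have "\<dots> = d j a \<oplus>\<^bsub>P j\<^esub> c \<odot>\<^bsub>P j\<^esub> d j y"
    unfolding ay(1) using aP ay(3) c by (simp add: hj)
  finally have "c \<odot>\<^bsub>P j\<^esub> d j y = \<ominus>\<^bsub>P j\<^esub> d j a"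
    using hj(1)[OF aP] hj(1)[OF ay(3)] c
    by (metis Pj.M.a_comm Pj.M.minus_equality Pj.smult_closed)
  also have "\<dots> \<in> seq_span (P j) cs"
    using mod_hom_seq_span[OF mod mod hom cs, of a j] ay(2) j(1) by (intro Pj.seq_span_minus cs) simp
  finally have "d j y \<in> seq_span (P j) cs"
    using Cons.prems(2)[of j] hj(1)[OF ay(3)] unfolding weakly_regular.simps by blast
  from Cons.IH[OF cs reg j(2) _ this] ay(3) j(1)
  obtain w z where wz: "w \<in> carrier (P (Suc i))" "z \<in> seq_span (P i) cs" "y = d i w \<oplus>\<^bsub>P i\<^esub> z"
    by auto
  have zP: "z \<in> carrier (P i)" using Pi.seq_span_closed[OF cs wz(2)] .
  have cw: "c \<odot>\<^bsub>P (Suc i)\<^esub> w \<in> carrier (P (Suc i))" using c wz(1) by simp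
  define x' where "x' = x \<oplus>\<^bsub>P (Suc i)\<^esub> \<ominus>\<^bsub>P (Suc i)\<^esub> (c \<odot>\<^bsub>P (Suc i)\<^esub> w)"
  have x': "x' \<in> carrier (P (Suc i))" using Cons.prems(4) cw by (simp add: x'_def)
  have dw: "c \<odot>\<^bsub>P i\<^esub> d i w \<in> carrier (P i)" using c hi(1)[OF wz(1)] by simp
  have "d i x' = d i x \<oplus>\<^bsub>P i\<^esub> \<ominus>\<^bsub>P i\<^esub> (c \<odot>\<^bsub>P i\<^esub> d i w)"
    using Cons.prems(4) cw c wz(1) by (simp add: x'_def hi mod_hom_minus[OF mod mod hom])
  also have "\<dots> = (a \<oplus>\<^bsub>P i\<^esub> c \<odot>\<^bsub>P i\<^esub> z) \<oplus>\<^bsub>P i\<^esub> (c \<odot>\<^bsub>P i\<^esub> d i w \<oplus>\<^bsub>P i\<^esub> \<ominus>\<^bsub>P i\<^esub> (c \<odot>\<^bsub>P i\<^esub> d i w))"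
    unfolding ay(1) wz(3) using aP zP c hi(1)[OF wz(1)] dw
    by (simp add: Pi.smult_r_distr Pi.M.a_ac del: Pi.M.r_neg)
  also have "\<dots> = a \<oplus>\<^bsub>P i\<^esub> c \<odot>\<^bsub>P i\<^esub> z"
    using aP zP c dw by (simp add: Pi.M.r_neg)
  also have "\<dots> \<in> seq_span (P i) cs"
    using ay(2) wz(2) c cs by (intro Pi.seq_span_add Pi.seq_span_smult)
  finally obtain w' z' where wz': "w' \<in> carrier (P (Suc (Suc i)))" "z' \<in> seq_span (P (Suc i)) cs"
    "x' = d (Suc i) w' \<oplus>\<^bsub>P (Suc i)\<^esub> z'"
    using Cons.IH[OF cs reg _ x'] Cons.prems(3) by auto
  have "x = x' \<oplus>\<^bsub>P (Suc i)\<^esub> c \<odot>\<^bsub>P (Suc i)\<^esub> w"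
    using Cons.prems(4) cw by (simp add: x'_def Ps.M.a_assoc Ps.M.l_neg)
  also have "\<dots> = d (Suc i) w' \<oplus>\<^bsub>P (Suc i)\<^esub> (z' \<oplus>\<^bsub>P (Suc i)\<^esub> c \<odot>\<^bsub>P (Suc i)\<^esub> w)"
    using wz'(3) cw mod_homD(1)[OF hom wz'(1)] Ps.seq_span_closed[OF cs wz'(2)] by (simp add: Ps.M.a_assoc)
  finally show ?case
    using wz'(1) Ps.seq_span_ConsI[OF wz'(2) wz(1)] by blast
qed

text \<open>
  For \<open>length cs = i\<close>, the quotient of \<open>P i\<close> by this submodule is the cokernel of the differential into
  degree \<open>i\<close>, that is the \<open>i\<close>-th syzygy module, reduced modulo \<open>cs\<close>.
\<close>

definition boundary_span :: "nat \<Rightarrow> 'a list \<Rightarrow> 'c set" where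
  "boundary_span i cs = {d i w \<oplus>\<^bsub>P i\<^esub> z | w z. w \<in> carrier (P (Suc i)) \<and> z \<in> seq_span (P i) cs}"

text \<open>
  The connecting homomorphism of Koszul homology on elements. If \<open>T\<close> kills \<open>v\<close> modulo boundaries and
  \<open>cs\<close>, then \<open>c v = d w + z\<close> for the next \<open>c\<close>, and \<open>w\<close> is the new element one degree higher. It is
  killed by \<open>T\<close> by exactness modulo \<open>cs\<close>; if it were trivial modulo boundaries and \<open>c # cs\<close>, then
  cancelling \<open>c\<close> would make \<open>v\<close> trivial.
\<close>

lemma socle_chase:
  assumes "set cs \<subseteq> T" "T \<subseteq> carrier R" "\<And>i. weakly_regular (P i) cs"
    and u: "u \<in> carrier (P 0)" "u \<notin> d 0 ` carrier (P 1)"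
      "\<And>t. t \<in> T \<Longrightarrow> t \<odot>\<^bsub>P 0\<^esub> u \<in> d 0 ` carrier (P 1)"
  shows "\<exists>v\<in>carrier (P (length cs)). v \<notin> boundary_span (length cs) cs \<and>
    (\<forall>t\<in>T. t \<odot>\<^bsub>P (length cs)\<^esub> v \<in> boundary_span (length cs) cs)"
  using assms(1,3)
proof (induction cs)
  case Nil
  interpret Module.module R "P 0" by (rule mod)
  have "boundary_span 0 [] = d 0 ` carrier (P 1)"
    using mod_homD(1)[OF hom[of 0]] by (force simp: boundary_span_def)
  then show ?case using u by auto
next
  case (Cons c cs)
  let ?i = "length cs"
  interpret Pi: Module.module R "P ?i" by (rule mod)
  interpret Ps: Module.module R "P (Suc ?i)" by (rule mod)
  note h = mod_homD[OF hom[of ?i]]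
  have cT: "c \<in> T" and c: "c \<in> carrier R" and cs: "set cs \<subseteq> carrier R" using Cons.prems assms(2) by auto
  have reg: "\<And>i. weakly_regular (P i) cs" using Cons.prems(2) by (meson weakly_regular.simps(2))
  obtain v where v: "v \<in> carrier (P ?i)" "v \<notin> boundary_span ?i cs"
    "\<And>t. t \<in> T \<Longrightarrow> t \<odot>\<^bsub>P ?i\<^esub> v \<in> boundary_span ?i cs"
    using Cons.IH[OF _ reg] Cons.prems(1) by auto
  obtain w z where wz: "c \<odot>\<^bsub>P ?i\<^esub> v = d ?i w \<oplus>\<^bsub>P ?i\<^esub> z" "w \<in> carrier (P (Suc ?i))" "z \<in> seq_span (P ?i) cs"
    using v(3)[OF cT] by (auto simp: boundary_span_def)
  have zP: "z \<in> carrier (P ?i)" using Pi.seq_span_closed[OF cs wz(3)] .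
  note dw = h(1)[OF wz(2)]
  have dw_eq: "d ?i w = c \<odot>\<^bsub>P ?i\<^esub> v \<oplus>\<^bsub>P ?i\<^esub> \<ominus>\<^bsub>P ?i\<^esub> z"
    unfolding wz(1) using dw zP by (simp add: Pi.M.a_assoc Pi.M.r_neg)
  \<comment> \<open>If \<open>t v = d w1 + z1\<close>, then \<open>t w - c w1\<close> is a cycle modulo \<open>cs\<close>, hence a boundary modulo \<open>cs\<close>.\<close>
  have "t \<odot>\<^bsub>P (Suc ?i)\<^esub> w \<in> boundary_span (Suc ?i) (c # cs)" if tT: "t \<in> T" for t
  proof -
    have t: "t \<in> carrier R" using tT assms(2) by blast
    obtain w1 z1 where wz1: "t \<odot>\<^bsub>P ?i\<^esub> v = d ?i w1 \<oplus>\<^bsub>P ?i\<^esub> z1" "w1 \<in> carrier (P (Suc ?i))" "z1 \<in> seq_span (P ?i) cs"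
      using v(3)[OF tT] by (auto simp: boundary_span_def)
    have z1P: "z1 \<in> carrier (P ?i)" using Pi.seq_span_closed[OF cs wz1(3)] .
    note dw1 = h(1)[OF wz1(2)]
    have dw1_eq: "d ?i w1 = t \<odot>\<^bsub>P ?i\<^esub> v \<oplus>\<^bsub>P ?i\<^esub> \<ominus>\<^bsub>P ?i\<^esub> z1"
      unfolding wz1(1) using dw1 z1P by (simp add: Pi.M.a_assoc Pi.M.r_neg)
    define x where "x = t \<odot>\<^bsub>P (Suc ?i)\<^esub> w \<oplus>\<^bsub>P (Suc ?i)\<^esub> \<ominus>\<^bsub>P (Suc ?i)\<^esub> (c \<odot>\<^bsub>P (Suc ?i)\<^esub> w1)"
    have xP: "x \<in> carrier (P (Suc ?i))" using t c wz(2) wz1(2) by (simp add: x_def)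
    have "d ?i x = t \<odot>\<^bsub>P ?i\<^esub> d ?i w \<oplus>\<^bsub>P ?i\<^esub> \<ominus>\<^bsub>P ?i\<^esub> (c \<odot>\<^bsub>P ?i\<^esub> d ?i w1)"
      using t c wz(2) wz1(2) by (simp add: x_def h mod_hom_minus[OF mod mod hom])
    also have "\<dots> = (\<ominus>\<^bsub>P ?i\<^esub> (t \<odot>\<^bsub>P ?i\<^esub> z) \<oplus>\<^bsub>P ?i\<^esub> c \<odot>\<^bsub>P ?i\<^esub> z1)
        \<oplus>\<^bsub>P ?i\<^esub> (t \<odot>\<^bsub>P ?i\<^esub> (c \<odot>\<^bsub>P ?i\<^esub> v) \<oplus>\<^bsub>P ?i\<^esub> \<ominus>\<^bsub>P ?i\<^esub> (c \<odot>\<^bsub>P ?i\<^esub> (t \<odot>\<^bsub>P ?i\<^esub> v)))"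
      unfolding dw_eq dw1_eq using t c v(1) zP z1P
      by (simp add: Pi.smult_r_distr Pi.smult_r_minus Pi.M.minus_add Pi.M.a_ac)
    also have "t \<odot>\<^bsub>P ?i\<^esub> (c \<odot>\<^bsub>P ?i\<^esub> v) = c \<odot>\<^bsub>P ?i\<^esub> (t \<odot>\<^bsub>P ?i\<^esub> v)"
      using t c v(1) by (simp add: Pi.smult_assoc1[symmetric] Pi.R.m_comm)
    also have "(\<ominus>\<^bsub>P ?i\<^esub> (t \<odot>\<^bsub>P ?i\<^esub> z) \<oplus>\<^bsub>P ?i\<^esub> c \<odot>\<^bsub>P ?i\<^esub> z1)
        \<oplus>\<^bsub>P ?i\<^esub> (c \<odot>\<^bsub>P ?i\<^esub> (t \<odot>\<^bsub>P ?i\<^esub> v) \<oplus>\<^bsub>P ?i\<^esub> \<ominus>\<^bsub>P ?i\<^esub> (c \<odot>\<^bsub>P ?i\<^esub> (t \<odot>\<^bsub>P ?i\<^esub> v)))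
        = \<ominus>\<^bsub>P ?i\<^esub> (t \<odot>\<^bsub>P ?i\<^esub> z) \<oplus>\<^bsub>P ?i\<^esub> c \<odot>\<^bsub>P ?i\<^esub> z1"
      using t c v(1) zP z1P by (simp add: Pi.M.r_neg)
    also have "\<dots> \<in> seq_span (P ?i) cs"
      using t c wz(3) wz1(3) cs by (intro Pi.seq_span_add Pi.seq_span_minus Pi.seq_span_smult)
    finally obtain w2 z2 where wz2: "w2 \<in> carrier (P (Suc (Suc ?i)))" "z2 \<in> seq_span (P (Suc ?i)) cs"
      "x = d (Suc ?i) w2 \<oplus>\<^bsub>P (Suc ?i)\<^esub> z2"
      using exact_modulo[OF cs reg order_refl xP] by auto
    have "t \<odot>\<^bsub>P (Suc ?i)\<^esub> w = x \<oplus>\<^bsub>P (Suc ?i)\<^esub> c \<odot>\<^bsub>P (Suc ?i)\<^esub> w1"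
      using t c wz(2) wz1(2) by (simp add: x_def Ps.M.a_assoc Ps.M.l_neg)
    also have "\<dots> = d (Suc ?i) w2 \<oplus>\<^bsub>P (Suc ?i)\<^esub> (z2 \<oplus>\<^bsub>P (Suc ?i)\<^esub> c \<odot>\<^bsub>P (Suc ?i)\<^esub> w1)"
      using wz2(3) wz1(2) c mod_homD(1)[OF hom wz2(1)] Ps.seq_span_closed[OF cs wz2(2)]
      by (simp add: Ps.M.a_assoc)
    finally show ?thesis
      unfolding boundary_span_def using wz2(1) Ps.seq_span_ConsI[OF wz2(2) wz1(2)] by blast
  qed
  \<comment> \<open>If \<open>w = d w2 + z2 + c y\<close>, then \<open>c (v - d y)\<close> vanishes modulo \<open>cs\<close>, and \<open>c\<close> can be cancelled.\<close>
  moreover have "w \<notin> boundary_span (Suc ?i) (c # cs)"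
  proof
    assume "w \<in> boundary_span (Suc ?i) (c # cs)"
    then obtain w2 z2 y where w2: "w = d (Suc ?i) w2 \<oplus>\<^bsub>P (Suc ?i)\<^esub> (z2 \<oplus>\<^bsub>P (Suc ?i)\<^esub> c \<odot>\<^bsub>P (Suc ?i)\<^esub> y)"
      "w2 \<in> carrier (P (Suc (Suc ?i)))" "z2 \<in> seq_span (P (Suc ?i)) cs" "y \<in> carrier (P (Suc ?i))"
      by (auto simp: boundary_span_def)
    have z2P: "z2 \<in> carrier (P (Suc ?i))" using Ps.seq_span_closed[OF cs w2(3)] .
    note dy = h(1)[OF w2(4)] and dz2 = h(1)[OF z2P] and dw2 = mod_homD(1)[OF hom w2(2)]
    have dw': "d ?i w = d ?i z2 \<oplus>\<^bsub>P ?i\<^esub> c \<odot>\<^bsub>P ?i\<^esub> d ?i y"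
      unfolding w2(1) using w2(2,4) z2P c dw2 dy dz2 by (simp add: h d_d)
    define v' where "v' = v \<oplus>\<^bsub>P ?i\<^esub> \<ominus>\<^bsub>P ?i\<^esub> d ?i y"
    have v'P: "v' \<in> carrier (P ?i)" using v(1) dy by (simp add: v'_def)
    have "c \<odot>\<^bsub>P ?i\<^esub> v' = (d ?i z2 \<oplus>\<^bsub>P ?i\<^esub> z) \<oplus>\<^bsub>P ?i\<^esub>
        (c \<odot>\<^bsub>P ?i\<^esub> d ?i y \<oplus>\<^bsub>P ?i\<^esub> \<ominus>\<^bsub>P ?i\<^esub> (c \<odot>\<^bsub>P ?i\<^esub> d ?i y))"
      unfolding v'_def using v(1) dy c dz2 zP
      by (simp add: Pi.smult_r_distr Pi.smult_r_minus wz(1) dw' Pi.M.a_ac)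
    also have "\<dots> = d ?i z2 \<oplus>\<^bsub>P ?i\<^esub> z"
      using dy c dz2 zP by (simp add: Pi.M.r_neg)
    also have "\<dots> \<in> seq_span (P ?i) cs"
      using mod_hom_seq_span[OF mod mod hom cs w2(3)] wz(3) by (intro Pi.seq_span_add cs)
    finally have "v' \<in> seq_span (P ?i) cs"
      using Cons.prems(2)[of ?i] v'P unfolding weakly_regular.simps by blast
    moreover have "v = d ?i y \<oplus>\<^bsub>P ?i\<^esub> v'"
      using v(1) dy by (simp add: v'_def Pi.M.a_ac Pi.M.r_neg)
    ultimately show False using v(2) w2(4) by (auto simp: boundary_span_def)
  qed
  ultimately show ?case using wz(2) by auto
qed

lemma nontrivial_at_length:
  assumes "set cs \<subseteq> carrier R" "\<And>i. weakly_regular (P i) cs"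
    and "u \<in> carrier (P 0)" "u \<notin> d 0 ` carrier (P 1)"
    and "\<And>c. c \<in> set cs \<Longrightarrow> c \<odot>\<^bsub>P 0\<^esub> u \<in> d 0 ` carrier (P 1)"
  shows "carrier (P (length cs)) \<noteq> {\<zero>\<^bsub>P (length cs)\<^esub>}"
proof -
  let ?n = "length cs"
  interpret Pn: Module.module R "P ?n" by (rule mod)
  interpret Ps: Module.module R "P (Suc ?n)" by (rule mod)
  obtain v where v: "v \<in> carrier (P ?n)" "v \<notin> boundary_span ?n cs"
    using socle_chase[OF order_refl assms] by blast
  have "d ?n \<zero>\<^bsub>P (Suc ?n)\<^esub> \<oplus>\<^bsub>P ?n\<^esub> \<zero>\<^bsub>P ?n\<^esub> = \<zero>\<^bsub>P ?n\<^esub>"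
    using mod_hom_zero[OF mod mod hom] by simp
  then have "\<zero>\<^bsub>P ?n\<^esub> \<in> boundary_span ?n cs"
    unfolding boundary_span_def using Pn.seq_span_zero[OF assms(1)] Ps.M.zero_closed by force
  with v show ?thesis by auto
qed

end

section \<open>Variables on projective modules and the projective dimension\<close>

lemma free_module_simps [simp]:
  "\<zero>\<^bsub>free_module R B\<^esub> = (\<lambda>_. \<zero>\<^bsub>R\<^esub>)"
  "f \<oplus>\<^bsub>free_module R B\<^esub> g = (\<lambda>b. f b \<oplus>\<^bsub>R\<^esub> g b)"
  "a \<odot>\<^bsub>free_module R B\<^esub> f = (\<lambda>b. a \<otimes>\<^bsub>R\<^esub> f b)"
  by (simp_all add: free_module_def)

lemma carrier_free_module:
  "f \<in> carrier (free_module (poly_ring V :: ('v, 'k::field) mpoly ring) B) \<longleftrightarrow>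
     (\<forall>b. f b \<in> carrier (poly_ring V)) \<and> finite {b. f b \<noteq> 0} \<and> {b. f b \<noteq> 0} \<subseteq> B"
  by (auto simp: free_module_def)

lemma module_free_module:
  "Module.module (poly_ring V) (free_module (poly_ring V :: ('v, 'k::field) mpoly ring) B)" (is "Module.module ?S ?F")
proof (rule Module.moduleI)
  show "cring ?S" by (rule cring_poly_ring)
  have add: "f \<oplus>\<^bsub>?F\<^esub> g \<in> carrier ?F" if "f \<in> carrier ?F" "g \<in> carrier ?F" for f g
  proof -
    have "{b. f b + g b \<noteq> 0} \<subseteq> {b. f b \<noteq> 0} \<union> {b. g b \<noteq> 0}" by auto
    with that show ?thesis
      by (auto simp: carrier_free_module poly_ring_closed intro: finite_subset)
  qed
  show "abelian_group ?F"
  proof (rule abelian_groupI)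
    fix f assume "f \<in> carrier ?F"
    then show "\<exists>g\<in>carrier ?F. g \<oplus>\<^bsub>?F\<^esub> f = \<zero>\<^bsub>?F\<^esub>"
      by (intro bexI[of _ "\<lambda>b. - f b"]) (auto simp: carrier_free_module poly_ring_closed)
  qed (use add in \<open>auto simp: carrier_free_module poly_ring_closed add.assoc add.commute\<close>)
  fix a f assume "a \<in> carrier ?S" "f \<in> carrier ?F"
  moreover have "{b. a * f b \<noteq> 0} \<subseteq> {b. f b \<noteq> 0}" by auto
  ultimately show "a \<odot>\<^bsub>?F\<^esub> f \<in> carrier ?F"
    by (auto simp: carrier_free_module poly_ring_closed intro: finite_subset)
qed (auto simp: algebra_simps)

text \<open>
  On a free module over the polynomial ring, the submodule generated by variables is described by
  a condition on the monomials of the coordinates.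
\<close>

lemma seq_span_free_module:
  fixes V :: "'v set" and vs :: "'v list" and B :: "'b set"
  defines "F \<equiv> free_module (poly_ring V :: ('v, 'k::field) mpoly ring) B"
  assumes "set vs \<subseteq> V"
  shows "f \<in> seq_span F (map mvar vs) \<longleftrightarrow> f \<in> carrier F \<and> (\<forall>b. meets (set vs) (f b))"
  using assms(2)
proof (induction vs arbitrary: f)
  case Nil
  show ?case by (auto simp: F_def carrier_free_module poly_ring_closed supported_def fun_eq_iff)
next
  case (Cons v vs)
  let ?S = "poly_ring V :: ('v, 'k) mpoly ring"
  interpret F: Module.module ?S F unfolding F_def by (rule module_free_module)
  have v: "v \<in> V" using Cons.prems by simp
  show ?case
  proof
    assume "f \<in> seq_span F (map mvar (v # vs))"
    then obtain g h where gh: "f = (\<lambda>b. g b + mvar v * h b)" "g \<in> seq_span F (map mvar vs)" "h \<in> carrier F"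
      by (auto simp: F_def)
    have g: "g \<in> carrier F" "\<And>b. meets (set vs) (g b)" using Cons gh(2) by auto
    have "f = g \<oplus>\<^bsub>F\<^esub> mvar v \<odot>\<^bsub>F\<^esub> h" by (simp add: gh(1) F_def)
    then have "f \<in> carrier F"
      using F.M.a_closed[OF g(1) F.smult_closed[OF mvar_in_poly_ring[OF v] gh(3)]] by simp
    moreover have "meets (set (v # vs)) (f b)" for b
    proof -
      have "meets (set (v # vs)) (g b)" using g(2) by (rule supported_mono) auto
      moreover have "meets (set (v # vs)) (mvar v * h b)"
        by (rule supported_mult[where P = "\<lambda>m. v \<in> Poly_Mapping.keys m" and Q = "\<lambda>_. True"])
          (auto simp: supported_mvar keys_add_nat supported_def[of "\<lambda>_. True"])
      ultimately show ?thesis unfolding gh(1) by (rule supported_add)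
    qed
    ultimately show "f \<in> carrier F \<and> (\<forall>b. meets (set (v # vs)) (f b))" by blast
  next
    assume f: "f \<in> carrier F \<and> (\<forall>b. meets (set (v # vs)) (f b))"
    \<comment> \<open>A name for the splitting, so that it can be chosen simultaneously for all coordinates \<open>b\<close>.\<close>
    define split where "split b g h \<longleftrightarrow> f b = mvar v * g + h \<and> g \<in> carrier ?S \<and> h \<in> carrier ?S \<and>
        meets (set vs) h \<and> (f b = 0 \<longrightarrow> g = 0 \<and> h = 0)" for b g h
    have "\<exists>g h. split b g h" for b
    proof -
      have "f b \<in> carrier ?S" using f by (auto simp: F_def carrier_free_module)
      then obtain g h where gh: "f b = mvar v * g + h" "g \<in> carrier ?S" "h \<in> carrier ?S"
        "Poly_Mapping.keys h \<subseteq> {m \<in> Poly_Mapping.keys (f b). v \<notin> Poly_Mapping.keys m}"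
        "f b = 0 \<longrightarrow> g = 0 \<and> h = 0"
        by (rule poly_split[where v = v])
      have "meets (set vs) h" using f gh(4) by (fastforce simp: supported_def)
      with gh show ?thesis unfolding split_def by blast
    qed
    then obtain g h where "\<And>b. split b (g b) (h b)" by metis
    then have gh: "\<And>b. f b = mvar v * g b + h b" "\<And>b. g b \<in> carrier ?S" "\<And>b. h b \<in> carrier ?S"
      "\<And>b. meets (set vs) (h b)" "\<And>b. f b = 0 \<longrightarrow> g b = 0 \<and> h b = 0"
      unfolding split_def by blast+
    have "{b. g b \<noteq> 0} \<subseteq> {b. f b \<noteq> 0}" "{b. h b \<noteq> 0} \<subseteq> {b. f b \<noteq> 0}" using gh(5) by blast+
    moreover have "finite {b. f b \<noteq> 0}" "{b. f b \<noteq> 0} \<subseteq> B" using f by (auto simp: F_def carrier_free_module)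
    ultimately have "g \<in> carrier F" "h \<in> carrier F"
      using gh(2,3) unfolding F_def carrier_free_module by (meson finite_subset order_trans)+
    moreover from this have "h \<in> seq_span F (map mvar vs)" using Cons gh(4) by auto
    moreover have "f = h \<oplus>\<^bsub>F\<^esub> mvar v \<odot>\<^bsub>F\<^esub> g" using gh(1) by (simp add: F_def fun_eq_iff add.commute)
    ultimately show "f \<in> seq_span F (map mvar (v # vs))" using F.seq_span_ConsI by simp
  qed
qed

lemma weakly_regular_free_module:
  fixes V :: "'v set"
  shows "distinct vs \<Longrightarrow> set vs \<subseteq> V \<Longrightarrow>
    weakly_regular (free_module (poly_ring V :: ('v, 'k::field) mpoly ring) B) (map mvar vs)"
proof (induction vs)
  case (Cons v vs)
  have "meets (set vs) p" if "meets (set vs) (mvar v * p)" for p :: "('v, 'k) mpoly"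
    using that by (rule supported_of_mvar_mult) (use Cons.prems in \<open>auto simp: keys_add_nat\<close>)
  then show ?case using Cons by (auto simp: seq_span_free_module)
qed simp

lemma weakly_regular_projective:
  fixes V :: "'v set" and P :: "(('v, 'k::field) mpoly, 'c) module"
  assumes "projective (poly_ring V) P" "distinct vs" "set vs \<subseteq> V"
  shows "weakly_regular P (map mvar vs)"
proof -
  let ?S = "poly_ring V :: ('v, 'k) mpoly ring"
  obtain B :: "'c set" and s p where P: "Module.module ?S P" "s \<in> mod_hom ?S P (free_module ?S B)"
    "p \<in> mod_hom ?S (free_module ?S B) P" "\<And>x. x \<in> carrier P \<Longrightarrow> p (s x) = x"
    using assms(1) by (auto simp: projective_def)
  show ?thesis
  proof (rule weakly_regular_summand[OF P(1) module_free_module P(2,3)])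
    show "p (s x) = x" if "x \<in> carrier P" for x using P(4)[OF that] .
    show "set (map mvar vs) \<subseteq> carrier ?S"
      using assms(3) by (auto intro: mvar_in_poly_ring)
    show "weakly_regular (free_module ?S B) (map mvar vs)"
      by (rule weakly_regular_free_module[OF assms(2,3)])
  qed
qed

text \<open>
  A lift of the class of \<open>u\<close> to \<open>P 0\<close> is not a boundary, but becomes one when multiplied by a variable
  from \<open>C\<close>. The chase along the variables in \<open>C\<close> ends in a nonzero element of \<open>P (card C)\<close>.
\<close>

theorem proj_dim_ge:
  fixes V :: "'v set" and I :: "('v, 'k::field) mpoly set"
  assumes I: "ideal I (poly_ring V)" and C: "finite C" "C \<subseteq> V"
    and u: "u \<in> carrier (poly_ring V)" "u \<notin> I" "\<And>c. c \<in> C \<Longrightarrow> mvar c * u \<in> I"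
  shows "enat (card C) \<le> proj_dim TYPE('c) (poly_ring V) (quot_module (poly_ring V) I)"
  unfolding proj_dim_def
proof (rule Inf_greatest)
  let ?S = "poly_ring V :: ('v, 'k) mpoly ring"
  let ?M = "quot_module ?S I"
  note Q = cring_poly_ring I
  fix l assume "l \<in> {enat n | n. \<exists>(P :: nat \<Rightarrow> (('v, 'k) mpoly, 'c) module) d e.
     projective_resolution ?S ?M P d e \<and> (\<forall>i > n. carrier (P i) = {\<zero>\<^bsub>P i\<^esub>})}"
  then obtain n and P :: "nat \<Rightarrow> (('v, 'k) mpoly, 'c) module" and d e where l: "l = enat n"
    and res: "projective_resolution ?S ?M P d e" and len: "\<forall>i > n. carrier (P i) = {\<zero>\<^bsub>P i\<^esub>}"
    by blast
  have proj: "\<And>i. projective ?S (P i)" using res by (simp add: projective_resolution_def)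
  interpret module_complex ?S P d
    by (rule module_complex.intro)
      (use res in \<open>simp_all add: projective_resolution_def projective_def\<close>)
  obtain vs where vs: "set vs = C" "distinct vs" using finite_distinct_list[OF C(1)] by blast
  have e: "e \<in> mod_hom ?S (P 0) ?M" "e ` carrier (P 0) = carrier ?M"
    and ker: "d 0 ` carrier (P 1) = mod_ker (P 0) ?M e"
    using res by (auto simp: projective_resolution_def)
  obtain u0 where u0: "u0 \<in> carrier (P 0)" "e u0 = I +>\<^bsub>?S\<^esub> u"
  proof -
    have "I +>\<^bsub>?S\<^esub> u \<in> carrier ?M" using u(1) by (auto simp: quot_carrier[OF Q])
    then have "I +>\<^bsub>?S\<^esub> u \<in> e ` carrier (P 0)" unfolding e(2) .
    then show thesis using that by (auto elim!: imageE)
  qed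
  interpret P0: Module.module ?S "P 0" by (rule mod)
  have "carrier (P (length (map mvar vs :: ('v, 'k) mpoly list))) \<noteq>
      {\<zero>\<^bsub>P (length (map mvar vs :: ('v, 'k) mpoly list))\<^esub>}"
  proof (rule nontrivial_at_length)
    show "set (map mvar vs) \<subseteq> carrier ?S" using vs C by (auto intro!: mvar_in_poly_ring)
    show "weakly_regular (P i) (map mvar vs)" for i
      using weakly_regular_projective[OF proj vs(2)] vs(1) C(2) by blast
    show "u0 \<in> carrier (P 0)" by fact
    show "u0 \<notin> d 0 ` carrier (P 1)"
      unfolding ker using coset_eq_ideal_iff[OF Q u(1)] u(2) u0
      by (simp add: mod_ker_def quot_module_simps(2))
    fix c :: "('v, 'k) mpoly" assume "c \<in> set (map mvar vs)"
    then obtain v where v: "v \<in> C" "c = mvar v" using vs(1) by auto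
    then have c: "c \<in> carrier ?S" using C by (auto intro!: mvar_in_poly_ring)
    have "e (c \<odot>\<^bsub>P 0\<^esub> u0) = I +>\<^bsub>?S\<^esub> (c * u)"
      using mod_homD(3)[OF e(1) c u0(1)] u0(2) quot_smult[OF Q c u(1)] by simp
    also have "\<dots> = I"
      using coset_eq_ideal_iff[OF Q, of "c * u"] u(1,3) v c by (simp add: poly_ring_closed)
    finally show "c \<odot>\<^bsub>P 0\<^esub> u0 \<in> d 0 ` carrier (P 1)"
      unfolding ker using u0(1) c by (simp add: mod_ker_def quot_module_simps(2))
  qed
  then have "\<not> n < length vs" using len by auto
  then show "enat (card C) \<le> l" using vs distinct_card[of vs] by (simp add: l)
qed

section \<open>Neighborhood ideals and double domination\<close>

lemma card_closed_neighborhood: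
  assumes "finite (verts G)"
  shows "finite (closed_neighborhood G v)" "card (closed_neighborhood G v) = Suc (degree G v)"
proof -
  have "finite (neighborhood G v)" "v \<notin> neighborhood G v"
    using assms by (auto simp: neighborhood_def)
  then show "finite (closed_neighborhood G v)" "card (closed_neighborhood G v) = Suc (degree G v)"
    by (simp_all add: closed_neighborhood_def degree_def)
qed

text \<open>
  The set \<open>C\<close> is a double dominating set of the graph, and tightness is its minimality: no vertex can
  be removed from \<open>C\<close>. A generator of the ideal omits one vertex of a closed neighborhood, so
  double dominating sets are exactly the vertex sets that meet every generator, and a tight closed
  neighborhood without the second vertex of \<open>C\<close> yields a generator with a prescribed single
  vertex in \<open>C\<close>.
\<close>

theorem nbhd_ideal_bounds:
  fixes G :: "'v graph" and C :: "'v set"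
  defines "S \<equiv> poly_ring (verts G) :: ('v, 'k::field) mpoly ring"
  defines "M \<equiv> quot_module S (nbhd_ideal G (degree G))"
  assumes fin: "finite (verts G)" and C: "C \<subseteq> verts G"
    and double: "\<And>v. v \<in> verts G \<Longrightarrow> 2 \<le> card (closed_neighborhood G v \<inter> C)"
    and tight: "\<And>c. c \<in> C \<Longrightarrow> \<exists>v\<in>verts G. c \<in> closed_neighborhood G v \<and> card (closed_neighborhood G v \<inter> C) = 2"
  shows "enat (card C) \<le> proj_dim TYPE('c) S M"
    and "depth S (irrelevant_ideal (verts G)) M \<le> enat (card (verts G - C))"
proof -
  let ?V = "verts G"
  let ?gens = "{(\<Prod>w\<in>W. mvar w) | W v. v \<in> ?V \<and> W \<subseteq> closed_neighborhood G v \<and> card W = degree G v}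
    :: ('v, 'k) mpoly set"
  let ?I = "nbhd_ideal G (degree G) :: ('v, 'k) mpoly set"
  let ?T = "{p \<in> carrier S. meets C p}"
  let ?u = "\<Prod>v\<in>?V - C. mvar v :: ('v, 'k) mpoly"
  interpret cring S unfolding S_def by (rule cring_poly_ring)
  have finC: "finite C" using C fin by (rule finite_subset)
  have nbhd: "closed_neighborhood G v \<subseteq> ?V" if "v \<in> ?V" for v
    using that by (auto simp: closed_neighborhood_def neighborhood_def)
  have prod_closed: "(\<Prod>w\<in>W. mvar w :: ('v, 'k) mpoly) \<in> carrier S" if "W \<subseteq> ?V" for W
    using that finite_subset[OF that fin]
    by (simp add: S_def mvar_prod_eq_single carrier_poly_ring supported_single keys_sum_singles del: One_nat_def)
  have gens: "?gens \<subseteq> ?T"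
  proof
    fix p assume "p \<in> ?gens"
    then obtain W v where W: "p = (\<Prod>w\<in>W. mvar w)" "v \<in> ?V" "W \<subseteq> closed_neighborhood G v" "card W = degree G v"
      by blast
    have finW: "finite W" using W(3) card_closed_neighborhood(1)[OF fin] by (rule finite_subset)
    have "W \<inter> C \<noteq> {}"
    proof
      assume "W \<inter> C = {}"
      then have "W \<subseteq> closed_neighborhood G v - closed_neighborhood G v \<inter> C" using W(3) by auto
      then have "card W \<le> card (closed_neighborhood G v - closed_neighborhood G v \<inter> C)"
        using card_closed_neighborhood(1)[OF fin] by (intro card_mono) auto
      also have "\<dots> = Suc (degree G v) - card (closed_neighborhood G v \<inter> C)"
        using card_closed_neighborhood[OF fin, of v] by (simp add: card_Diff_subset)
      finally have "card W \<le> Suc (degree G v) - card (closed_neighborhood G v \<inter> C)" .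
      moreover have "card (closed_neighborhood G v \<inter> C) \<le> card (closed_neighborhood G v)"
        using card_closed_neighborhood(1)[OF fin] by (intro card_mono) auto
      ultimately show False
        using W(4) double[OF W(2)] card_closed_neighborhood(2)[OF fin, of v] by linarith
    qed
    then show "p \<in> ?T"
      using prod_closed[of W] W nbhd[OF W(2)] finW
      by (auto simp: mvar_prod_eq_single supported_single keys_sum_singles simp del: One_nat_def)
  qed
  have gens_carrier: "?gens \<subseteq> carrier S" using gens by blast
  have I_eq: "?I = Idl\<^bsub>S\<^esub> ?gens" by (simp add: nbhd_ideal_def S_def)
  have I: "ideal ?I S" unfolding I_eq by (rule genideal_ideal[OF gens_carrier])
  have "ideal ?T S" unfolding S_def by (rule ideal_supported) (auto simp: keys_add_nat)
  then have I_sub: "?I \<subseteq> ?T" unfolding I_eq using gens by (rule genideal_minimal)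
  have u: "?u \<in> carrier S" by (rule prod_closed) auto
  have "?u \<notin> ?T"
    using fin by (auto simp: mvar_prod_eq_single supported_def keys_sum_singles simp del: One_nat_def)
  then have u_notin: "?u \<notin> ?I" using I_sub by blast
  have cu: "mvar c * ?u \<in> ?I" if c: "c \<in> C" for c
  proof -
    obtain v where v: "v \<in> ?V" "c \<in> closed_neighborhood G v" "card (closed_neighborhood G v \<inter> C) = 2"
      using tight[OF c] by blast
    then obtain c' where c': "closed_neighborhood G v \<inter> C = {c, c'}" "c' \<noteq> c"
    proof -
      have "card (closed_neighborhood G v \<inter> C - {c}) = 1" using v c by simp
      then obtain c' where "closed_neighborhood G v \<inter> C - {c} = {c'}" by (rule card_1_singletonE)
      then show thesis using v(2) c by (intro that[of c']) auto
    qed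
    \<comment> \<open>The generator that omits the partner \<open>c'\<close> divides \<open>c u\<close>.\<close>
    define W where "W = closed_neighborhood G v - {c'}"
    have "card W = degree G v"
      using c' card_closed_neighborhood[OF fin, of v] by (auto simp: W_def)
    then have "(\<Prod>w\<in>W. mvar w) \<in> ?gens" using v(1) by (auto simp: W_def)
    then have WI: "(\<Prod>w\<in>W. mvar w) \<in> ?I" unfolding I_eq using genideal_self[OF gens_carrier] by blast
    have Wc: "W = insert c (W - {c})" "W - {c} \<subseteq> ?V - C" "finite W"
      using c' v(2) nbhd[OF v(1)] card_closed_neighborhood(1)[OF fin, of v] by (auto simp: W_def)
    have "mvar c * ?u = mvar c * ((\<Prod>w\<in>(?V - C) - (W - {c}). mvar w) * (\<Prod>w\<in>W - {c}. mvar w))"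
      by (subst prod.subset_diff[OF Wc(2)]) (use fin in auto)
    also have "\<dots> = (\<Prod>w\<in>(?V - C) - (W - {c}). mvar w) * (mvar c * (\<Prod>w\<in>W - {c}. mvar w))"
      by (simp add: algebra_simps)
    also have "mvar c * (\<Prod>w\<in>W - {c}. mvar w) = (\<Prod>w\<in>W. mvar w :: ('v, 'k) mpoly)"
      by (rule prod.remove[symmetric]) (use Wc(1,3) in blast)+
    also have "(\<Prod>w\<in>(?V - C) - (W - {c}). mvar w) * (\<Prod>w\<in>W. mvar w) \<in> ?I"
      using ideal.I_l_closed[OF I WI prod_closed[of "(?V - C) - (W - {c})"]] by (auto simp: S_def)
    finally show ?thesis .
  qed
  show "enat (card C) \<le> proj_dim TYPE('c) S M"
    unfolding M_def S_def using I[unfolded S_def] finC C u[unfolded S_def] u_notin cu by (rule proj_dim_ge)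
  show "depth S (irrelevant_ideal ?V) M \<le> enat (card (?V - C))"
    unfolding M_def S_def using fin C I[unfolded S_def]
  proof (rule depth_le)
    show "meets C p" if "p \<in> ?I" for p using I_sub that by blast
  qed (rule cu)
qed

section \<open>The ladder with an odd number of rungs\<close>

lemma in_closed_neighborhood_ladder:
  assumes "1 \<le> i" "i \<le> r"
  shows "VX j \<in> closed_neighborhood (ladder r) (VX i) \<longleftrightarrow> 1 \<le> j \<and> j \<le> r \<and> (j = i \<or> j = i + 1 \<or> i = j + 1)"
    and "VY j \<in> closed_neighborhood (ladder r) (VX i) \<longleftrightarrow> j = i"
    and "VY j \<in> closed_neighborhood (ladder r) (VY i) \<longleftrightarrow> 1 \<le> j \<and> j \<le> r \<and> (j = i \<or> j = i + 1 \<or> i = j + 1)"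
    and "VX j \<in> closed_neighborhood (ladder r) (VY i) \<longleftrightarrow> j = i"
  using assms
  by (auto simp: closed_neighborhood_def neighborhood_def ladder_def doubleton_eq_iff image_iff)

definition odd_columns :: "nat \<Rightarrow> ladder_vertex set" where
  "odd_columns r = VX ` {i \<in> {1..r}. odd i} \<union> VY ` {i \<in> {1..r}. odd i}"

lemma in_odd_columns:
  "VX j \<in> odd_columns r \<longleftrightarrow> 1 \<le> j \<and> j \<le> r \<and> odd j"
  "VY j \<in> odd_columns r \<longleftrightarrow> 1 \<le> j \<and> j \<le> r \<and> odd j"
  by (auto simp: odd_columns_def)

text \<open>
  A vertex in an odd column sees itself and the other end of its rung. A vertex in an even column
  sees its left and right neighbors; the right one exists because the last column is odd.
\<close>

lemma closed_neighborhood_odd_columns: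
  assumes "odd r" "v \<in> verts (ladder r)"
  shows "card (closed_neighborhood (ladder r) v \<inter> odd_columns r) = 2"
proof -
  have v: "v \<in> VX ` {1..r} \<union> VY ` {1..r}" using assms(2) by (simp add: ladder_def)
  define i where "i = (case v of VX i \<Rightarrow> i | VY i \<Rightarrow> i)"
  have i: "1 \<le> i" "i \<le> r" "v = VX i \<or> v = VY i" using v by (auto simp: i_def)
  note mem = in_closed_neighborhood_ladder[OF i(1,2)]
  show ?thesis
  proof (cases "odd i")
    case True
    have "w \<in> closed_neighborhood (ladder r) v \<inter> odd_columns r \<longleftrightarrow> w \<in> {VX i, VY i}" for w
      using True i by (cases w) (auto simp: mem in_odd_columns)
    then have "closed_neighborhood (ladder r) v \<inter> odd_columns r = {VX i, VY i}" by blast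
    then show ?thesis by simp
  next
    case False
    then have "2 \<le> i" "i < r" using i(1,2) assms(1) by (auto simp: order_le_less)
    then obtain k where k: "i = Suc (Suc k)" by (metis add_2_eq_Suc le_Suc_ex)
    have "even k" using False k by simp
    have index: "(1 \<le> j \<and> j \<le> r \<and> (j = i \<or> j = i + 1 \<or> i = j + 1)) \<and> 1 \<le> j \<and> j \<le> r \<and> odd j
        \<longleftrightarrow> j = Suc k \<or> j = Suc i" for j
      using \<open>i < r\<close> \<open>even k\<close> k by presburger
    have row: "closed_neighborhood (ladder r) v \<inter> odd_columns r = {X (Suc k), X (Suc i)}"
      if X: "v = X i" "X = VX \<or> X = VY" for X
    proof -
      have "w \<in> closed_neighborhood (ladder r) (X i) \<inter> odd_columns r \<longleftrightarrow> w \<in> {X (Suc k), X (Suc i)}" for w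
        using X(2)
      proof
        assume "X = VX"
        then show ?thesis
          using index \<open>\<not> odd i\<close> by (cases w) (simp_all add: mem in_odd_columns del: One_nat_def)
      next
        assume "X = VY"
        then show ?thesis
          using index \<open>\<not> odd i\<close> by (cases w) (simp_all add: mem in_odd_columns del: One_nat_def)
      qed
      then show ?thesis unfolding X(1) by blast
    qed
    from i(3) obtain X where X: "v = X i" "X = VX \<or> X = VY" by blast
    have "X (Suc k) \<noteq> X (Suc i)" using X(2) k by auto
    then show ?thesis unfolding row[OF X] by simp
  qed
qed

lemma card_columns: "finite A \<Longrightarrow> card (VX ` A \<union> VY ` A) = 2 * card A"
  by (subst card_Un_disjoint) (auto simp: card_image inj_on_def)

lemma card_odd_columns:
  assumes "odd r"
  shows "card (odd_columns r) = r + 1" "card (verts (ladder r) - odd_columns r) = r - 1"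
proof -
  obtain k where k: "r = 2 * k + 1" using assms by (rule oddE)
  have "{i \<in> {1..r}. odd i} = (\<lambda>j. 2 * j + 1) ` {..k}"
    by (auto simp: k image_iff elim!: oddE)
  then have "card {i \<in> {1..r}. odd i} = Suc k" by (simp add: card_image inj_on_def)
  then show odd: "card (odd_columns r) = r + 1" by (simp add: odd_columns_def card_columns k)
  have "odd_columns r \<subseteq> verts (ladder r)" "finite (odd_columns r)"
    by (auto simp: odd_columns_def ladder_def)
  then show "card (verts (ladder r) - odd_columns r) = r - 1"
    using odd by (simp add: card_Diff_subset) (simp add: ladder_def card_columns)
qed

theorem corollary3p9:
  fixes r :: nat
  assumes "odd r"
  shows "let G = ladder r;
             S = poly_ring (verts G) :: (ladder_vertex, 'k::field) mpoly ring;
             M = quot_module S (nbhd_ideal G (degree G))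
         in proj_dim TYPE('c) S M \<ge> enat (r + 1) \<and>
            depth S (irrelevant_ideal (verts G)) M \<le> enat (r - 1)"
proof -
  have fin: "finite (verts (ladder r))" and sub: "odd_columns r \<subseteq> verts (ladder r)"
    by (auto simp: ladder_def odd_columns_def)
  note two = closed_neighborhood_odd_columns[OF assms]
  have double: "2 \<le> card (closed_neighborhood (ladder r) v \<inter> odd_columns r)"
    if "v \<in> verts (ladder r)" for v using two[OF that] by simp
  have tight: "\<exists>v\<in>verts (ladder r). c \<in> closed_neighborhood (ladder r) v \<and>
      card (closed_neighborhood (ladder r) v \<inter> odd_columns r) = 2"
    if "c \<in> odd_columns r" for c
  proof -
    have "c \<in> verts (ladder r)" using that sub by blast
    with two[OF this] show ?thesis by (intro bexI[of _ c]) (simp_all add: closed_neighborhood_def)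
  qed
  show ?thesis
    unfolding Let_def
    using nbhd_ideal_bounds[OF fin sub double tight] card_odd_columns[OF assms] by simp
qed

end
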